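(* Let $n,d,M\ge1$, $T>0$ and $t_1<\dots<t_M$ in $[0,T]$. Assume that $V$ is continuously embedded in $C^1_0(\mathbb{R}^d,\mathbb{R}^d)$ and that its reproducing kernel $K_V$ is of class $C^2$. Let $q\mapsto\mathcal{K}_q\in\mathcal{M}_{nd}(\mathbb{R})$ be a continuous map on $\mathbb{R}^{nd}\times\mathbb{R}^{nd}$ such that, for some fixed $c>0$, $\langle\mathcal{K}_qu,u\rangle\ge c|u|^2$ for all $q\in\mathbb{R}^{nd}\times\mathbb{R}^{nd}$ and $u\in\mathbb{R}^{nd}$, and let $C(q,u)=\frac12\langle\mathcal{K}_qu,u\rangle$. Let $E:\mathbb{R}^{nd}\times\mathbb{R}^{nd}\to[0,+\infty)$ be lower semi-continuous with $E(q_0)\to+\infty$ as $|q_0|\to\infty$, and for $1\le k\le M$ let $g_k:\mathbb{R}^{nd}\times\mathbb{R}^{nd}\to[0,+\infty)$ be continuous. Then the function $$J(q_0,u)=E(q_0)+\int_0^TC(q_t^{q_0,u},u_t)\,dt+\sum_{k=1}^Mg_k(q_{t_k}^{q_0,u}),$$ defined for $(q_0,u)\in(\mathbb{R}^{nd}\times\mathbb{R}^{nd})\times L^2([0,T],\mathbb{R}^{nd})$, reaches its minimum.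
   Context: $V$ is a Hilbert space of vector fields $\mathbb{R}^d\to\mathbb{R}^d$. $C^1_0(\mathbb{R}^d,\mathbb{R}^d)$ is the space of $C^1$ vector fields vanishing at infinity (together with their first derivatives) with norm $|v|_{1,\infty}=\sup|v|+\sup|dv|$; continuous embedding means there is a constant $C$ with $|v|_{1,\infty}\le C|v|_V$ for all $v\in V$. Then $V$ is a reproducing kernel Hilbert space with matrix-valued kernel $K_V:\mathbb{R}^d\times\mathbb{R}^d\to\mathcal{M}_d(\mathbb{R})$, characterized by: for all $z',\alpha'\in\mathbb{R}^d$, $K_V(\cdot,z')\alpha'\in V$ and $\langle v,K_V(\cdot,z')\alpha'\rangle_V=v(z')^T\alpha'$ for all $v\in V$. For $x=(x_1,\dots,x_n)$, $p=(p_1,\dots,p_n)\in(\mathbb{R}^d)^n=\mathbb{R}^{nd}$, $$H_0(x,p)=\tfrac12\sum_{i,j=1}^n p_i^TK_V(x_i,x_j)p_j.$$ For $q_0=(x_0,p_0)\in\mathbb{R}^{nd}\times\mathbb{R}^{nd}$ and $u\in L^2([0,T],\mathbb{R}^{nd})$, $q^{q_0,u}=(x,p)\in C([0,T],\mathbb{R}^{nd}\times\mathbb{R}^{nd})$ denotes the (unique, globally defined) solution of $$x_t=x_0+\int_0^t \partial_pH_0(x_s,p_s)\,ds,\qquad p_t=p_0+\int_0^t\big(-\partial_xH_0(x_s,p_s)+u_s\big)\,ds,\qquad t\in[0,T].$$ *)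

theory Defs
  imports "HOL-Analysis.Analysis"
begin

section \<open>Hilbert spaces of vector fields\<close>

text \<open>
  A Hilbert space of vector fields is a Hilbert space \<open>'v\<close> together with a map \<open>ev\<close> which sends
  each element to the vector field it is; \<open>ev\<close> is injective, and the vector space operations of
  \<open>'v\<close> are the pointwise ones.
\<close>

definition hilbert_space_of_fields ::
  "('v::{real_inner, complete_space} \<Rightarrow> real^'d \<Rightarrow> real^'d) \<Rightarrow> bool" where
  "hilbert_space_of_fields ev \<longleftrightarrow> inj ev \<and> (\<forall>z. linear (\<lambda>v. ev v z))"

definition C1_0 :: "(real^'d \<Rightarrow> real^'d) set" where
  "C1_0 = {w. \<exists>w' :: real^'d \<Rightarrow> (real^'d) \<Rightarrow>\<^sub>L (real^'d).
      (\<forall>z. (w has_derivative blinfun_apply (w' z)) (at z)) \<and> continuous_on UNIV w' \<and>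
      (w \<longlongrightarrow> 0) at_infinity \<and> (w' \<longlongrightarrow> 0) at_infinity}"

text \<open>The suprema are only meaningful when bounded, which is the case on \<open>C1_0\<close>.\<close>

definition norm_1_inf :: "(real^'d \<Rightarrow> real^'d) \<Rightarrow> real" where
  "norm_1_inf w = (SUP z. norm (w z)) + (SUP z. onorm (frechet_derivative w (at z)))"

definition continuously_embedded_C1_0 ::
  "('v::real_normed_vector \<Rightarrow> real^'d \<Rightarrow> real^'d) \<Rightarrow> bool" where
  "continuously_embedded_C1_0 ev \<longleftrightarrow>
     range ev \<subseteq> C1_0 \<and> (\<exists>C. \<forall>v. norm_1_inf (ev v) \<le> C * norm v)"

definition reproducing_kernel ::
  "('v::real_inner \<Rightarrow> real^'d \<Rightarrow> real^'d) \<Rightarrow> (real^'d \<Rightarrow> real^'d \<Rightarrow> real^'d^'d) \<Rightarrow> bool" where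
  "reproducing_kernel ev K \<longleftrightarrow>
     (\<forall>z' \<alpha>'. \<exists>k. ev k = (\<lambda>z. K z z' *v \<alpha>') \<and> (\<forall>v. v \<bullet> k = ev v z' \<bullet> \<alpha>'))"

definition class_C2 :: "('a::real_normed_vector \<Rightarrow> 'b::real_normed_vector) \<Rightarrow> bool" where
  "class_C2 f \<longleftrightarrow> (\<exists>(f' :: 'a \<Rightarrow> 'a \<Rightarrow>\<^sub>L 'b) (f'' :: 'a \<Rightarrow> 'a \<Rightarrow>\<^sub>L 'a \<Rightarrow>\<^sub>L 'b).
      (\<forall>x. (f has_derivative blinfun_apply (f' x)) (at x)) \<and>
      (\<forall>x. (f' has_derivative blinfun_apply (f'' x)) (at x)) \<and> continuous_on UNIV f'')"


section \<open>The controlled Hamiltonian system\<close>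

text \<open>
  Elements \<open>(x\<^sub>1, \<dots>, x\<^sub>n)\<close> of \<open>(\<real>\<^sup>d)\<^sup>n\<close> are of type \<open>real^'d^'n\<close>.
\<close>

definition H0 ::
  "(real^'d \<Rightarrow> real^'d \<Rightarrow> real^'d^'d) \<Rightarrow> real^'d^'n \<Rightarrow> real^'d^'n \<Rightarrow> real" where
  "H0 K x p = (1/2) * (\<Sum>i\<in>UNIV. \<Sum>j\<in>UNIV. (p$i) \<bullet> (K (x$i) (x$j) *v (p$j)))"

definition grad :: "('a::real_inner \<Rightarrow> real) \<Rightarrow> 'a \<Rightarrow> 'a" where
  "grad f x = (THE D. GDERIV f x :> D)"

definition dx_H0 ::
  "(real^'d \<Rightarrow> real^'d \<Rightarrow> real^'d^'d) \<Rightarrow> real^'d^'n \<Rightarrow> real^'d^'n \<Rightarrow> real^'d^'n" where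
  "dx_H0 K x p = grad (\<lambda>x'. H0 K x' p) x"

definition dp_H0 ::
  "(real^'d \<Rightarrow> real^'d \<Rightarrow> real^'d^'d) \<Rightarrow> real^'d^'n \<Rightarrow> real^'d^'n \<Rightarrow> real^'d^'n" where
  "dp_H0 K x p = grad (\<lambda>p'. H0 K x p') p"

text \<open>Elements of \<open>L\<^sup>2\<close> are represented by functions rather than by classes modulo null sets.\<close>

definition L2 :: "real \<Rightarrow> (real \<Rightarrow> 'a::euclidean_space) set" where
  "L2 T = {u \<in> borel_measurable (lebesgue_on {0..T}).
             integrable (lebesgue_on {0..T}) (\<lambda>t. (norm (u t))\<^sup>2)}"

definition solution ::
  "(real^'d \<Rightarrow> real^'d \<Rightarrow> real^'d^'d) \<Rightarrow> real \<Rightarrow> (real^'d^'n) \<times> (real^'d^'n) \<Rightarrow>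
   (real \<Rightarrow> real^'d^'n) \<Rightarrow> (real \<Rightarrow> (real^'d^'n) \<times> (real^'d^'n)) \<Rightarrow> bool" where
  "solution K T q0 u q \<longleftrightarrow> continuous_on {0..T} q \<and>
     (\<forall>t\<in>{0..T}.
        fst (q t) = fst q0 +
          (\<integral>s. dp_H0 K (fst (q s)) (snd (q s)) \<partial>lebesgue_on {0..t}) \<and>
        snd (q t) = snd q0 +
          (\<integral>s. - dx_H0 K (fst (q s)) (snd (q s)) + u s \<partial>lebesgue_on {0..t}))"

text \<open>
  The trajectory is a function on \<open>[0,T]\<close>; membership in \<open>extensional {0..T}\<close> fixes the irrelevant
  values outside this interval, so that the description is unique.
\<close>

definition trajectory ::
  "(real^'d \<Rightarrow> real^'d \<Rightarrow> real^'d^'d) \<Rightarrow> real \<Rightarrow> (real^'d^'n) \<times> (real^'d^'n) \<Rightarrow>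
   (real \<Rightarrow> real^'d^'n) \<Rightarrow> real \<Rightarrow> (real^'d^'n) \<times> (real^'d^'n)" where
  "trajectory K T q0 u = (THE q. q \<in> extensional {0..T} \<and> solution K T q0 u q)"


section \<open>The functional\<close>

text \<open>The identification of \<open>(\<real>\<^sup>d)\<^sup>n\<close> with \<open>\<real>\<^sup>n\<^sup>d\<close>, on which matrices of size \<open>nd\<close> act.\<close>

definition flat :: "real^'d^'n \<Rightarrow> real^('n \<times> 'd)" where
  "flat u = (\<chi> m. u $ fst m $ snd m)"

definition quad_form :: "real^('n \<times> 'd)^('n \<times> 'd) \<Rightarrow> real^'d^'n \<Rightarrow> real" where
  "quad_form A u = (A *v flat u) \<bullet> flat u"

definition cost ::
  "('q \<Rightarrow> real^('n \<times> 'd)^('n \<times> 'd)) \<Rightarrow> 'q \<Rightarrow> real^'d^'n \<Rightarrow> real" where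
  "cost \<K> q u = (1/2) * quad_form (\<K> q) u"

definition lower_semicontinuous :: "('a::topological_space \<Rightarrow> real) \<Rightarrow> bool" where
  "lower_semicontinuous f \<longleftrightarrow> (\<forall>a. open {x. a < f x})"

definition J ::
  "(real^'d \<Rightarrow> real^'d \<Rightarrow> real^'d^'d) \<Rightarrow> real \<Rightarrow>
   ((real^'d^'n) \<times> (real^'d^'n) \<Rightarrow> real^('n \<times> 'd)^('n \<times> 'd)) \<Rightarrow>
   ((real^'d^'n) \<times> (real^'d^'n) \<Rightarrow> real) \<Rightarrow>
   nat \<Rightarrow> (nat \<Rightarrow> real) \<Rightarrow> (nat \<Rightarrow> (real^'d^'n) \<times> (real^'d^'n) \<Rightarrow> real) \<Rightarrow>
   (real^'d^'n) \<times> (real^'d^'n) \<Rightarrow> (real \<Rightarrow> real^'d^'n) \<Rightarrow> real" where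
  "J K T \<K> E M t g q0 u =
     E q0 + (\<integral>s. cost \<K> (trajectory K T q0 u s) (u s) \<partial>lebesgue_on {0..T})
          + (\<Sum>k=1..M. g k (trajectory K T q0 u (t k)))"

end

theory Submission
  imports "HOL-Complex_Analysis.Great_Picard" Defs
begin

text \<open>
  The direct method. The control only enters the momentum equation through its primitive, which is
  continuous, so trajectories solve an integral equation with locally Lipschitz right-hand side and
  exist by a fixed point argument as long as they stay bounded. They cannot blow up: \<open>2 H\<^sub>0\<close> is the squared norm of
  the velocity field in \<open>V\<close>, the free flow conserves it, and the control changes this norm at a rate
  of at most a constant times \<open>|u|\<close>; given this, positions grow linearly and momenta are
  controlled by Gronwall's inequality. Hence along a minimising sequence the trajectories are bounded
  and equicontinuous, and converge uniformly up to a subsequence (Arzela-Ascoli). Their limit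
  determines a function \<open>U\<close> to which the primitives of the controls converge, and near-minimisers of
  the cost among the controls with primitive close to \<open>U\<close> converge strongly in \<open>L\<^sup>2\<close> to a
  control with primitive \<open>U\<close> and no larger cost, which drives the limit trajectory.
\<close>

section \<open>Integral equations with locally Lipschitz right-hand side\<close>

text \<open>Coercivity bounds the controls of a minimising sequence only in L^2, where bounded
  sequences need not have strongly convergent subsequences, and \<open>\<K>\<close> depends on the
  unknown trajectory. Both difficulties are met by taking compactness from the trajectories: uniform
  convergence fixes the limit of the primitives, and lets the moving matrix
  \<open>\<K> (q m s)\<close> be replaced by \<open>\<K> (z s)\<close> with vanishing error, so that
  one fixed convex quadratic functional remains. The final control is constructed afresh and need
  not be a limit of the minimising controls; its primitive alone shows that it drives the limit
  trajectory, since the integral equation sees nothing else of it. Boundedness cannot rest on linear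
  growth of the Hamiltonian field, because the force \<open>gx\<close> grows quadratically in the
  momenta. The energy bounds one of the two factors and leaves linear growth. The global constants
  come from the embedding; the \<open>C^2\<close> kernel supplies Lipschitz constants on
  balls.\<close>

definition lipschitz_on_balls :: "('a::real_normed_vector \<Rightarrow> 'b::real_normed_vector) \<Rightarrow> bool" where
  "lipschitz_on_balls f \<longleftrightarrow> (\<forall>R. \<exists>L. L-lipschitz_on (cball 0 R) f)"

text \<open>\<open>W\<close> collects the initial value and the primitive of the control, so a rough
  control enters only through a continuous function.\<close>

definition integral_solution ::
  "('q::euclidean_space \<Rightarrow> 'q) \<Rightarrow> (real \<Rightarrow> 'q) \<Rightarrow> real \<Rightarrow> (real \<Rightarrow> 'q) \<Rightarrow> bool" where
  "integral_solution F W \<tau> q \<longleftrightarrow> continuous_on {0..\<tau>} q \<and>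
     (\<forall>t\<in>{0..\<tau>}. q t = W t + integral {0..t} (\<lambda>s. F (q s)))"

text \<open>Freezing a function beyond the end points of \<open>[0,T]\<close> places it in the
  complete type of bounded continuous functions, where Banach's fixed point theorem applies.\<close>

lemma clamped_bcontfun:
  fixes h :: "real \<Rightarrow> 'a::real_normed_vector"
  assumes "0 \<le> T" "continuous_on {0..T} h"
  shows "(\<lambda>t. h (max 0 (min T t))) \<in> bcontfun"
proof -
  have "continuous_on UNIV (\<lambda>t. h (max 0 (min T t)))"
    by (rule continuous_on_compose2[OF assms(2)]) (use assms(1) in \<open>auto intro!: continuous_intros\<close>)
  moreover have "bounded (h ` {0..T})"
    using assms(2) compact_continuous_image compact_imp_bounded compact_Icc by blast
  then have "bounded (range (\<lambda>t. h (max 0 (min T t))))"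
    by (rule bounded_subset) (use assms(1) in auto)
  ultimately show ?thesis by (auto simp: bcontfun_def)
qed

lemma integral_exp_scaled:
  fixes l :: real
  assumes "l > 0" "0 \<le> \<tau>"
  shows "integral {0..\<tau>} (\<lambda>s. exp (l * s)) = (exp (l * \<tau>) - 1) / l"
proof -
  have "((\<lambda>s. exp (l * s)) has_integral (exp (l * \<tau>) / l - exp (l * 0) / l)) {0..\<tau>}"
    by (rule fundamental_theorem_of_calculus[OF assms(2)])
       (use assms(1) in \<open>auto intro!: derivative_eq_intros simp: has_real_derivative_iff_has_vector_derivative[symmetric]\<close>)
  then show ?thesis by (simp add: diff_divide_distrib integral_unique)
qed

lemma integral_solution_continuous_rhs:
  fixes F :: "'q::euclidean_space \<Rightarrow> 'q"
  assumes "continuous_on {0..\<tau>} q" "continuous_on UNIV F"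
  shows "continuous_on {0..\<tau>} (\<lambda>s. F (q s))"
  using continuous_on_compose2[OF assms(2,1)] by auto

lemma integral_solution_restrict:
  assumes "integral_solution F W \<tau> q" "\<sigma> \<le> \<tau>"
  shows "integral_solution F W \<sigma> q"
  using assms continuous_on_subset[of "{0..\<tau>}" q "{0..\<sigma>}"]
  unfolding integral_solution_def by auto

text \<open>Picard iteration in Bielecki's exponentially weighted sup norm: in terms of
  \<open>exp (- l * t) *\<^sub>R q t\<close> the integral operator contracts with factor
  \<open>L / l\<close>, whatever the length of the interval, so no short-time solutions have to be
  glued.\<close>

lemma integral_solution_lipschitz:
  fixes F :: "'q::euclidean_space \<Rightarrow> 'q"
  assumes T: "0 \<le> T" and W: "continuous_on {0..T} W" and F: "L-lipschitz_on UNIV F"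
  shows "\<exists>q. integral_solution F W T q \<and>
    (\<forall>q'. integral_solution F W T q' \<longrightarrow> (\<forall>t\<in>{0..T}. q' t = q t))"
proof -
  have L: "L \<ge> 0" using F by (auto simp: lipschitz_on_def)
  \<comment> \<open>\<open>2 * L\<close> yields the factor 1/2; the added 1 keeps \<open>l\<close>
    positive when \<open>L = 0\<close>.\<close>
  define l where "l = 2 * L + 1"
  have l: "l > 0" "L / l \<le> 1/2" using L by (auto simp: l_def field_simps)
  define cl where "cl t = max 0 (min T t)" for t
  have cl: "cl t \<in> {0..T}" for t using T by (auto simp: cl_def)
  have cl_id: "cl t = t" if "t \<in> {0..T}" for t using that by (auto simp: cl_def)
  have Fc: "continuous_on UNIV F" using F by (rule lipschitz_on_continuous_on)
  define h where "h y t = exp (- l * t) *\<^sub>R (W t + integral {0..t} (\<lambda>s. F (exp (l * s) *\<^sub>R y s)))"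
    for y and t :: real
  have Fy: "continuous_on {0..\<tau>} (\<lambda>s. F (exp (l * s) *\<^sub>R y s))" if "continuous_on {0..\<tau>} y" for y \<tau>
    by (rule integral_solution_continuous_rhs[OF _ Fc]) (intro continuous_intros that)
  have h: "continuous_on {0..T} (h y)" if "continuous_on {0..T} y" for y
    unfolding h_def
    by (intro continuous_intros W indefinite_integral_continuous_1 integrable_continuous_real Fy that)
  define \<Phi> where "\<Phi> y = Bcontfun (\<lambda>t. h (apply_bcontfun y) (cl t))" for y
  have app: "apply_bcontfun (\<Phi> y) t = h (apply_bcontfun y) (cl t)" for y t
    unfolding \<Phi>_def
    by (subst Bcontfun_inverse) (auto simp: cl_def intro!: clamped_bcontfun T h)
  have contr: "\<forall>y z. dist (\<Phi> y) (\<Phi> z) \<le> 1/2 * dist y z"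
  proof (intro allI dist_bound)
    fix y z :: "real \<Rightarrow>\<^sub>C 'q" and t
    let ?\<tau> = "cl t" and ?D = "dist y z"
    have t: "0 \<le> ?\<tau>" using cl by auto
    let ?f = "\<lambda>y s. F (exp (l * s) *\<^sub>R apply_bcontfun y s)"
    have int: "?f y integrable_on {0..?\<tau>}" for y
      by (intro integrable_continuous_real Fy) auto
    have "norm (integral {0..?\<tau>} (\<lambda>s. ?f y s - ?f z s)) \<le> integral {0..?\<tau>} (\<lambda>s. L * ?D * exp (l * s))"
    proof (rule integral_norm_bound_integral)
      show "(\<lambda>s. ?f y s - ?f z s) integrable_on {0..?\<tau>}" using int by (intro integrable_diff)
      show "(\<lambda>s. L * ?D * exp (l * s)) integrable_on {0..?\<tau>}"
        by (intro integrable_continuous_real continuous_intros)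
      fix s
      have "norm (?f y s - ?f z s) \<le> L * dist (exp (l * s) *\<^sub>R apply_bcontfun y s) (exp (l * s) *\<^sub>R apply_bcontfun z s)"
        using lipschitz_onD[OF F] by (auto simp: dist_norm)
      also have "\<dots> = L * (exp (l * s) * dist (apply_bcontfun y s) (apply_bcontfun z s))"
        by (simp add: dist_norm flip: scaleR_diff_right)
      also have "\<dots> \<le> L * (exp (l * s) * ?D)"
        by (intro mult_left_mono dist_bounded L) auto
      finally show "norm (?f y s - ?f z s) \<le> L * ?D * exp (l * s)" by (simp add: ac_simps)
    qed
    also have "\<dots> = L * ?D * ((exp (l * ?\<tau>) - 1) / l)"
      using integral_exp_scaled[OF l(1) t] by simp
    finally have *: "norm (integral {0..?\<tau>} (\<lambda>s. ?f y s - ?f z s)) \<le> L * ?D * ((exp (l * ?\<tau>) - 1) / l)" .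
    have "dist (apply_bcontfun (\<Phi> y) t) (apply_bcontfun (\<Phi> z) t) =
        exp (- l * ?\<tau>) * norm (integral {0..?\<tau>} (\<lambda>s. ?f y s - ?f z s))"
      unfolding app h_def dist_norm
      by (simp add: integral_diff[OF int int] flip: scaleR_diff_right)
    also have "\<dots> \<le> exp (- l * ?\<tau>) * (L * ?D * ((exp (l * ?\<tau>) - 1) / l))"
      by (intro mult_left_mono *) auto
    also have "\<dots> = (L / l) * ?D * (exp (- l * ?\<tau>) * (exp (l * ?\<tau>) - 1))" by simp
    also have "\<dots> = (L / l) * ?D * (1 - exp (- l * ?\<tau>))"
      by (simp add: algebra_simps flip: exp_add)
    also have "\<dots> \<le> (L / l) * ?D * 1"
      using L l by (intro mult_left_mono) auto
    also have "\<dots> \<le> 1/2 * ?D" using mult_right_mono[OF l(2), of ?D] by simp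
    finally show "dist (apply_bcontfun (\<Phi> y) t) (apply_bcontfun (\<Phi> z) t) \<le> 1/2 * ?D" .
  qed
  have "\<exists>!y. \<Phi> y = y"
    by (rule banach_fix_type[OF _ _ contr]) auto
  then obtain y where y: "\<Phi> y = y" and uniq: "\<And>z. \<Phi> z = z \<Longrightarrow> z = y"
    by blast
  have eqy: "apply_bcontfun y t = h (apply_bcontfun y) t" if "t \<in> {0..T}" for t
    using app[of y t] y cl_id[OF that] by simp
  define q where "q t = exp (l * t) *\<^sub>R apply_bcontfun y t" for t
  have "integral_solution F W T q"
    unfolding integral_solution_def
  proof
    show "continuous_on {0..T} q" unfolding q_def by (intro continuous_intros) auto
    show "\<forall>t\<in>{0..T}. q t = W t + integral {0..t} (\<lambda>s. F (q s))"
    proof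
      fix t assume t: "t \<in> {0..T}"
      show "q t = W t + integral {0..t} (\<lambda>s. F (q s))"
        by (subst q_def, subst eqy[OF t]) (simp add: h_def q_def flip: exp_add)
    qed
  qed
  moreover have "q' t = q t" if q': "integral_solution F W T q'" and t: "t \<in> {0..T}" for q' t
  proof -
    \<comment> \<open>Uniqueness: any solution, rescaled and clamped, is again a fixed point of
      \<open>\<Phi>\<close>.\<close>
    define k where "k t = exp (- l * t) *\<^sub>R q' t" for t
    have k: "continuous_on {0..T} k"
      unfolding k_def using q' by (auto simp: integral_solution_def intro!: continuous_intros)
    define z where "z = Bcontfun (\<lambda>t. k (cl t))"
    have z: "apply_bcontfun z t = k (cl t)" for t
      unfolding z_def by (subst Bcontfun_inverse) (auto simp: cl_def intro!: clamped_bcontfun T k)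
    have "apply_bcontfun (\<Phi> z) t = apply_bcontfun z t" for t
    proof -
      have "integral {0..cl t} (\<lambda>s. F (exp (l * s) *\<^sub>R apply_bcontfun z s)) =
            integral {0..cl t} (\<lambda>s. F (q' s))"
      proof (rule integral_cong)
        fix s assume "s \<in> {0..cl t}"
        then have "cl s = s" using cl[of t] by (intro cl_id) auto
        then show "F (exp (l * s) *\<^sub>R apply_bcontfun z s) = F (q' s)"
          by (simp add: z k_def flip: exp_add)
      qed
      then show ?thesis
        using q' cl[of t] unfolding app h_def z k_def integral_solution_def by metis
    qed
    then have "\<Phi> z = z" by (rule bcontfun_eqI)
    then have "z = y" by (rule uniq)
    then have "exp (l * t) *\<^sub>R apply_bcontfun z t = q t" by (simp add: q_def)
    then show ?thesis by (simp add: z cl_id[OF t] k_def flip: exp_add)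
  qed
  ultimately show ?thesis by blast
qed

lemma integral_solution_cong:
  assumes "integral_solution F W \<tau> q" "\<And>t. t \<in> {0..\<tau>} \<Longrightarrow> G (q t) = F (q t)"
  shows "integral_solution G W \<tau> q"
  using assms unfolding integral_solution_def by (auto intro!: integral_cong)

text \<open>Composing \<open>F\<close> with the projection onto a ball makes it globally Lipschitz,
  and the a priori bound shows that the truncation is never felt. The bound is demanded at the end
  point of every shorter interval, since existence up to \<open>T\<close> is not known
  beforehand.\<close>

lemma integral_solution_apriori:
  fixes F :: "'q::euclidean_space \<Rightarrow> 'q"
  assumes T: "0 \<le> T" and W: "continuous_on {0..T} W" and F: "lipschitz_on_balls F"
    and bound: "\<And>\<tau> q. \<tau> \<in> {0..T} \<Longrightarrow> integral_solution F W \<tau> q \<Longrightarrow> norm (q \<tau>) \<le> R"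
  shows "\<exists>q. integral_solution F W T q \<and>
    (\<forall>q'. integral_solution F W T q' \<longrightarrow> (\<forall>t\<in>{0..T}. q' t = q t))"
proof -
  \<comment> \<open>The margin 1 separates the sphere of truncation from the a priori bound, so that
    reaching the sphere contradicts the bound.\<close>
  define B where "B = cball (0::'q) (\<bar>R\<bar> + 1)"
  obtain L where L: "L-lipschitz_on B F" using F unfolding lipschitz_on_balls_def B_def by blast
  have B: "convex B" "closed B" "B \<noteq> {}" by (auto simp: B_def)
  let ?pr = "closest_point B"
  define G where "G = F \<circ> ?pr"
  have "1-lipschitz_on UNIV ?pr"
    by (rule lipschitz_onI) (use closest_point_lipschitz[OF B] in auto)
  moreover have "L-lipschitz_on (?pr ` UNIV) F"
    by (rule lipschitz_on_subset[OF L]) (use closest_point_in_set[OF B(2,3)] in auto)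
  ultimately have "(L * 1)-lipschitz_on UNIV G"
    unfolding G_def by (rule lipschitz_on_compose)
  from integral_solution_lipschitz[OF T W this] obtain q where
    q: "integral_solution G W T q"
    and uniq: "\<And>q' t. integral_solution G W T q' \<Longrightarrow> t \<in> {0..T} \<Longrightarrow> q' t = q t" by blast
  have GF: "G z = F z" if "norm z \<le> \<bar>R\<bar> + 1" for z
    using that closest_point_self[of z B] by (auto simp: G_def B_def)
  have "integral_solution F W 0 q"
    using q T by (auto simp: integral_solution_def)
  then have q0: "norm (q 0) \<le> R" using bound[of 0 q] T by auto
  have cont: "continuous_on {0..s} (\<lambda>s. norm (q s))" if "s \<in> {0..T}" for s
    using q that continuous_on_subset[of "{0..T}" q "{0..s}"]
    by (auto simp: integral_solution_def intro!: continuous_intros)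
  define S where "S = {s \<in> {0..T}. norm (q s) = \<bar>R\<bar> + 1}"
  have IVT: "\<exists>s\<in>S. s \<le> t" if t: "t \<in> {0..T}" "\<bar>R\<bar> + 1 \<le> norm (q t)" for t
  proof -
    have "\<exists>s. 0 \<le> s \<and> s \<le> t \<and> norm (q s) = \<bar>R\<bar> + 1"
      using IVT'[of "\<lambda>s. norm (q s)" 0 "\<bar>R\<bar> + 1" t, OF _ t(2) _ cont[OF t(1)]] q0 t(1) by auto
    then show ?thesis using t by (auto simp: S_def)
  qed
  \<comment> \<open>Up to its first time \<open>\<tau>\<close> on the sphere the curve stays in the
    ball, hence solves the untruncated equation on \<open>[0,\<tau>]\<close>; the bound then gives
    at most \<open>R\<close> at \<open>\<tau>\<close>, less than
    \<open>\<bar>R\<bar> + 1\<close>.\<close>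
  have "S = {}"
  proof (rule ccontr)
    assume "S \<noteq> {}"
    have "closed S" unfolding S_def
      by (rule continuous_closed_preimage_constant[OF cont]) (use T in auto)
    moreover have "S \<subseteq> {0..T}" by (auto simp: S_def)
    ultimately have S: "compact S"
      by (meson bounded_closed_interval bounded_subset compact_eq_bounded_closed)
    obtain \<tau> where \<tau>: "\<tau> \<in> S" "\<And>s. s \<in> S \<Longrightarrow> \<tau> \<le> s"
      using compact_attains_inf[OF S \<open>S \<noteq> {}\<close>] by blast
    have \<tau>T: "\<tau> \<in> {0..T}" using \<tau> by (auto simp: S_def)
    have le: "norm (q s) \<le> \<bar>R\<bar> + 1" if s: "s \<in> {0..\<tau>}" for s
    proof (rule ccontr)
      assume *: "\<not> norm (q s) \<le> \<bar>R\<bar> + 1"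
      then obtain r where "r \<in> S" "r \<le> s" using IVT[of s] s \<tau>T by auto
      with \<tau>(2) s have "r = s" by force
      with * \<open>r \<in> S\<close> show False by (auto simp: S_def)
    qed
    have "integral_solution F W \<tau> q"
      by (rule integral_solution_cong[OF integral_solution_restrict[OF q]])
         (use \<tau>T le GF in auto)
    then have "norm (q \<tau>) \<le> R" using bound[OF \<tau>T] by blast
    then show False using \<tau>(1) by (auto simp: S_def)
  qed
  then have small: "norm (q t) < \<bar>R\<bar> + 1" if "t \<in> {0..T}" for t
    using IVT[OF that] by (metis empty_iff not_le)
  have "integral_solution F W T q"
    by (rule integral_solution_cong[OF q]) (use small GF in \<open>auto simp: less_imp_le\<close>)
  moreover have "q' t = q t" if q': "integral_solution F W T q'" and t: "t \<in> {0..T}" for q' t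
  proof -
    have "norm (q' s) \<le> \<bar>R\<bar> + 1" if "s \<in> {0..T}" for s
      using bound[OF that integral_solution_restrict[OF q', of s]] that by auto
    then have "integral_solution G W T q'"
      by (intro integral_solution_cong[OF q']) (use GF in auto)
    then show ?thesis using uniq t by blast
  qed
  ultimately show ?thesis by blast
qed

section \<open>A priori bounds for Hamiltonian systems with a rough control\<close>

text \<open>A one-sided Dini condition is used because the energy along a controlled trajectory need
  not be differentiable. The last time at which \<open>\<phi> t \<le> \<phi> 0 + \<eta> * t\<close>
  must be \<open>\<tau>\<close>, as the condition carries the inequality past any earlier time; then
  \<open>\<eta>\<close> tends to 0.\<close>

lemma dini_nonincreasing:
  fixes \<phi> :: "real \<Rightarrow> real"
  assumes \<tau>: "0 \<le> \<tau>" and cont: "continuous_on {0..\<tau>} \<phi>"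
    and dini: "\<And>s \<eta>. s \<in> {0..<\<tau>} \<Longrightarrow> \<eta> > 0 \<Longrightarrow>
      \<exists>\<delta>>0. \<forall>t\<in>{s<..\<tau>}. t < s + \<delta> \<longrightarrow> \<phi> t - \<phi> s \<le> \<eta> * (t - s)"
  shows "\<phi> \<tau> \<le> \<phi> 0"
proof -
  have *: "\<phi> \<tau> - \<phi> 0 \<le> \<eta> * \<tau>" if \<eta>: "\<eta> > 0" for \<eta>
  proof -
    define S where "S = {t \<in> {0..\<tau>}. \<phi> t - \<eta> * t \<in> {..\<phi> 0}}"
    have "closed S" unfolding S_def
      by (rule continuous_closed_preimage[unfolded vimage_def Int_def mem_Collect_eq])
         (auto intro!: continuous_intros cont)
    moreover have "S \<subseteq> {0..\<tau>}" by (auto simp: S_def)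
    ultimately have S: "compact S"
      by (meson bounded_closed_interval bounded_subset compact_eq_bounded_closed)
    have "0 \<in> S" using \<tau> by (auto simp: S_def)
    then obtain s where s: "s \<in> S" "\<And>t. t \<in> S \<Longrightarrow> t \<le> s"
      using compact_attains_sup[OF S] by blast
    have "s = \<tau>"
    proof (rule ccontr)
      assume "s \<noteq> \<tau>"
      then have s': "s \<in> {0..<\<tau>}" using s by (auto simp: S_def)
      from dini[OF this \<eta>] obtain \<delta> where \<delta>: "\<delta> > 0"
        "\<And>t. t \<in> {s<..\<tau>} \<Longrightarrow> t < s + \<delta> \<Longrightarrow> \<phi> t - \<phi> s \<le> \<eta> * (t - s)" by blast
      define t where "t = min \<tau> (s + \<delta> / 2)"
      have t: "t \<in> {s<..\<tau>}" "t < s + \<delta>" using \<delta>(1) s' by (auto simp: t_def)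
      have "t \<in> S" using \<delta>(2)[OF t] s(1) t s' by (auto simp: S_def algebra_simps)
      then show False using s(2) t by force
    qed
    then show ?thesis using s(1) by (simp add: S_def)
  qed
  show ?thesis
  proof (rule field_le_epsilon)
    fix e :: real assume e: "e > 0"
    have "\<phi> \<tau> - \<phi> 0 \<le> e / (\<tau> + 1) * \<tau>" by (rule *) (use e \<tau> in auto)
    also have "\<dots> \<le> e" using e \<tau> by (simp add: field_simps)
    finally show "\<phi> \<tau> \<le> \<phi> 0 + e" by simp
  qed
qed

lemma dini_has_real_derivative:
  fixes \<psi> :: "real \<Rightarrow> real"
  assumes "(\<psi> has_real_derivative D) (at s within {0..\<tau>})" "D \<le> 0" "\<eta> > 0" "s \<in> {0..<\<tau>}"
  shows "\<exists>\<delta>>0. \<forall>t\<in>{s<..\<tau>}. t < s + \<delta> \<longrightarrow> \<psi> t - \<psi> s \<le> \<eta> * (t - s)"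
proof -
  have "((\<lambda>t. (\<psi> t - \<psi> s) / (t - s)) \<longlongrightarrow> D) (at s within {0..\<tau>})"
    using assms(1) by (simp add: has_field_derivative_iff)
  moreover have "D < \<eta>" using assms by simp
  ultimately have "\<forall>\<^sub>F t in at s within {0..\<tau>}. (\<psi> t - \<psi> s) / (t - s) < \<eta>"
    by (rule order_tendstoD(2))
  then obtain \<delta> where \<delta>: "\<delta> > 0"
    "\<And>t. t \<in> {0..\<tau>} \<Longrightarrow> t \<noteq> s \<Longrightarrow> dist t s < \<delta> \<Longrightarrow> (\<psi> t - \<psi> s) / (t - s) < \<eta>"
    unfolding eventually_at by blast
  have "\<psi> t - \<psi> s \<le> \<eta> * (t - s)" if "t \<in> {s<..\<tau>}" "t < s + \<delta>" for t
  proof -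
    have "(\<psi> t - \<psi> s) / (t - s) < \<eta>" by (rule \<delta>(2)) (use that assms(4) in \<open>auto simp: dist_real_def\<close>)
    then show ?thesis using that by (simp add: divide_less_eq)
  qed
  then show ?thesis using \<delta>(1) by blast
qed

text \<open>The right-hand side \<open>I\<close> has derivative \<open>a * f t\<close>, at most
  \<open>a * I t\<close>, so \<open>I t * exp (- a * t)\<close> does not increase.\<close>

lemma gronwall:
  fixes f :: "real \<Rightarrow> real"
  assumes \<tau>: "0 \<le> \<tau>" and cont: "continuous_on {0..\<tau>} f" and a: "0 \<le> a"
    and f: "\<And>t. t \<in> {0..\<tau>} \<Longrightarrow> f t \<le> b + a * integral {0..t} f"
  shows "f \<tau> \<le> b * exp (a * \<tau>)"
proof -
  define I where "I t = b + a * integral {0..t} f" for t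
  have I: "(I has_real_derivative a * f t) (at t within {0..\<tau>})" if "t \<in> {0..\<tau>}" for t
    unfolding I_def
    using integral_has_vector_derivative[OF cont that]
    by (auto intro!: derivative_eq_intros simp: has_real_derivative_iff_has_vector_derivative)
  have D: "((\<lambda>t. I t * exp (- a * t)) has_real_derivative (a * (f t - I t) * exp (- a * t))) (at t within {0..\<tau>})"
    if "t \<in> {0..\<tau>}" for t
    by (rule derivative_eq_intros I that refl)+ (simp add: algebra_simps)
  have "I \<tau> * exp (- a * \<tau>) \<le> I 0 * exp (- a * 0)"
  proof (rule dini_nonincreasing[OF \<tau>])
    show "continuous_on {0..\<tau>} (\<lambda>t. I t * exp (- a * t))"
      by (rule DERIV_continuous_on[OF D])
    fix s \<eta> :: real assume s: "s \<in> {0..<\<tau>}" "\<eta> > 0"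
    show "\<exists>\<delta>>0. \<forall>t\<in>{s<..\<tau>}. t < s + \<delta> \<longrightarrow>
      I t * exp (- a * t) - I s * exp (- a * s) \<le> \<eta> * (t - s)"
    proof (rule dini_has_real_derivative[OF D _ s(2,1)])
      have "a * (f s - I s) \<le> 0" using s f[of s] a by (intro mult_nonneg_nonpos) (auto simp: I_def)
      then show "a * (f s - I s) * exp (- a * s) \<le> 0" by (rule mult_nonpos_nonneg) simp
    qed (use s in auto)
  qed
  then have "I \<tau> * exp (- a * \<tau>) * exp (a * \<tau>) \<le> b * exp (a * \<tau>)"
    by (intro mult_right_mono) (auto simp: I_def)
  then have "I \<tau> \<le> b * exp (a * \<tau>)" by (simp add: mult.assoc flip: exp_add)
  then show ?thesis using f[of \<tau>] \<tau> by (simp add: I_def)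
qed

lemma le_of_square_le:
  fixes a b :: real
  assumes "a * a \<le> b * a" "0 \<le> a" "0 \<le> b"
  shows "a \<le> b"
  using assms by (cases "a = 0") auto

text \<open>Along the ray \<open>x + t *\<^sub>R h\<close> the quadratic term disappears after
  division by \<open>t\<close>. This bounds the gradient of \<open>H\<close> from its increments,
  without differentiating the kernel.\<close>

lemma has_derivative_bound:
  fixes f :: "'a::real_normed_vector \<Rightarrow> real"
  assumes f: "(f has_derivative f') (at x)"
    and le: "\<And>h. \<bar>f (x + h) - f x\<bar> \<le> A * norm h + B * (norm h)\<^sup>2"
  shows "\<bar>f' h\<bar> \<le> A * norm h"
proof -
  have "((\<lambda>t. f (x + t *\<^sub>R h)) has_derivative (\<lambda>t. f' (t *\<^sub>R h))) (at 0)"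
    by (rule has_derivative_compose[of "\<lambda>t. x + t *\<^sub>R h" "\<lambda>t. t *\<^sub>R h" 0 UNIV f f'])
       (use f in \<open>auto intro!: derivative_eq_intros\<close>)
  moreover have "(\<lambda>t. f' (t *\<^sub>R h)) = (*) (f' h)"
    using has_derivative_linear[OF f] by (auto simp: linear_scale mult.commute)
  ultimately have "((\<lambda>t. f (x + t *\<^sub>R h)) has_real_derivative f' h) (at 0)"
    by (simp add: has_field_derivative_def)
  then have "((\<lambda>t. (f (x + t *\<^sub>R h) - f x) / t) \<longlongrightarrow> f' h) (at 0)"
    by (simp add: has_field_derivative_iff)
  then have "((\<lambda>t. (f (x + t *\<^sub>R h) - f x) / t) \<longlongrightarrow> f' h) (at_right 0)"
    by (rule filterlim_mono) (auto simp: at_le)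
  then have 1: "((\<lambda>t. \<bar>(f (x + t *\<^sub>R h) - f x) / t\<bar>) \<longlongrightarrow> \<bar>f' h\<bar>) (at_right 0)"
    by (rule tendsto_rabs)
  have 2: "((\<lambda>t. A * norm h + B * t * (norm h)\<^sup>2) \<longlongrightarrow> A * norm h + B * 0 * (norm h)\<^sup>2) (at_right 0)"
    by (intro tendsto_intros)
  have "\<forall>\<^sub>F t in at_right 0. \<bar>(f (x + t *\<^sub>R h) - f x) / t\<bar> \<le> A * norm h + B * t * (norm h)\<^sup>2"
    using eventually_at_right_less[of 0]
  proof eventually_elim
    case (elim t)
    have "\<bar>f (x + t *\<^sub>R h) - f x\<bar> \<le> t * (A * norm h + B * t * (norm h)\<^sup>2)"
      using le[of "t *\<^sub>R h"] elim by (simp add: algebra_simps power2_eq_square)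
    then show ?case using elim by (simp add: divide_le_eq mult.commute)
  qed
  from tendsto_le[OF _ 2 1 this] show ?thesis by simp
qed

lemma norm_sum_sq_bound:
  fixes a b :: "'a::real_inner"
  shows "\<bar>(norm (a + b))\<^sup>2 / 2 - (norm a)\<^sup>2 / 2\<bar> \<le> norm a * norm b + (norm b)\<^sup>2 / 2"
proof -
  have "(norm (a + b))\<^sup>2 / 2 - (norm a)\<^sup>2 / 2 = a \<bullet> b + (norm b)\<^sup>2 / 2"
    by (simp add: power2_norm_eq_inner inner_add inner_commute add_divide_distrib)
  moreover have "\<bar>a \<bullet> b\<bar> \<le> norm a * norm b" by (rule Cauchy_Schwarz_ineq2)
  ultimately show ?thesis by (smt (verit) zero_le_power2 divide_nonneg_pos)
qed

text \<open>Here \<open>v x p\<close> stands for the field \<open>\<Sum>\<^sub>i K(\<cdot>, x\<^sub>i) p\<^sub>i\<close> generated by the momenta.\<close>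

locale kernel_hamiltonian =
  fixes H :: "'b::euclidean_space \<times> 'b \<Rightarrow> real" and gx gp :: "'b \<times> 'b \<Rightarrow> 'b"
    and v :: "'b \<Rightarrow> 'b \<Rightarrow> 'v::real_inner" and C :: real
  assumes H_eq: "H (x, p) = (norm (v x p))\<^sup>2 / 2"
    and linear_v: "linear (v x)"
    and norm_v_le: "norm (v x p) \<le> C * norm p"
    and norm_v_diff_le: "norm (v (x + h) p - v x p) \<le> C * norm h * norm p"
    and C_nonneg: "0 \<le> C"
    and H_deriv: "(H has_derivative (\<lambda>h. gx q \<bullet> fst h + gp q \<bullet> snd h)) (at q)"
    and lipschitz_gx: "lipschitz_on_balls gx" and lipschitz_gp: "lipschitz_on_balls gp"
begin

text \<open>The Hamiltonian vector field, with the control left out.\<close>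

definition field :: "'b \<times> 'b \<Rightarrow> 'b \<times> 'b" where
  "field q = (gp q, - gx q)"

lemma lipschitz_field: "lipschitz_on_balls field"
  unfolding lipschitz_on_balls_def
proof
  fix R
  obtain L1 L2 where L: "L1-lipschitz_on (cball 0 R) gx" "L2-lipschitz_on (cball 0 R) gp"
    using lipschitz_gx lipschitz_gp unfolding lipschitz_on_balls_def by meson
  have "(sqrt (L2\<^sup>2 + L1\<^sup>2))-lipschitz_on (cball 0 R) field"
    unfolding field_def by (intro lipschitz_on_Pair L lipschitz_on_minus)
  then show "\<exists>L. L-lipschitz_on (cball 0 R) field" by blast
qed

lemma continuous_field: "continuous_on UNIV field"
proof (rule continuous_at_imp_continuous_on, rule ballI)
  fix z :: "'b \<times> 'b"
  obtain L where "L-lipschitz_on (cball 0 (norm z + 1)) field"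
    using lipschitz_field unfolding lipschitz_on_balls_def by blast
  then have "continuous_on (cball 0 (norm z + 1)) field" by (rule lipschitz_on_continuous_on)
  then show "isCont field z"
    by (rule continuous_on_interior) auto
qed

lemma integral_field:
  fixes t :: real
  assumes "continuous_on {0..t} q"
  shows "integral {0..t} (\<lambda>s. field (q s)) =
    (integral {0..t} (\<lambda>s. gp (q s)), - integral {0..t} (\<lambda>s. gx (q s)))"
proof -
  have i: "(\<lambda>s. field (q s)) integrable_on {0..t}"
    by (intro integrable_continuous_real integral_solution_continuous_rhs[OF assms continuous_field])
  have "fst (integral {0..t} (\<lambda>s. field (q s))) = integral {0..t} (\<lambda>s. fst (field (q s)))"
    "snd (integral {0..t} (\<lambda>s. field (q s))) = integral {0..t} (\<lambda>s. snd (field (q s)))"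
    using integral_linear[OF i bounded_linear_fst] integral_linear[OF i bounded_linear_snd]
    by (auto simp: o_def)
  then show ?thesis
    by (intro prod_eqI) (simp_all only: fst_conv snd_conv field_def integral_neg)
qed

text \<open>\<open>v x\<close> is linear, so to first order the increment of \<open>H\<close> in the
  momentum is at most \<open>norm (v x p) * norm (v x k)\<close>. The speed of the points is thus
  bounded in terms of the energy alone.\<close>

lemma norm_gp_le: "norm (gp (x, p)) \<le> C * norm (v x p)"
proof -
  let ?g = "gp (x, p)"
  have "((\<lambda>k. H (x, k)) has_derivative (\<lambda>k. ?g \<bullet> k)) (at p)"
    using has_derivative_compose[OF has_derivative_Pair[OF has_derivative_const has_derivative_ident] H_deriv]
    by simp
  then have "\<bar>?g \<bullet> ?g\<bar> \<le> (norm (v x p) * C) * norm ?g"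
  proof (rule has_derivative_bound)
    fix k
    have vk: "norm (v x k) \<le> C * norm k" by (rule norm_v_le)
    have "\<bar>H (x, p + k) - H (x, p)\<bar> \<le> norm (v x p) * norm (v x k) + (norm (v x k))\<^sup>2 / 2"
      unfolding H_eq linear_add[OF linear_v] by (rule norm_sum_sq_bound)
    also have "\<dots> \<le> norm (v x p) * (C * norm k) + (C * norm k)\<^sup>2 / 2"
      by (intro add_mono mult_left_mono divide_right_mono power_mono vk) auto
    finally show "\<bar>H (x, p + k) - H (x, p)\<bar> \<le> norm (v x p) * C * norm k + (C\<^sup>2 / 2) * (norm k)\<^sup>2"
      by (simp add: power_mult_distrib mult.assoc)
  qed
  then have "norm ?g * norm ?g \<le> (C * norm (v x p)) * norm ?g"
    by (simp add: mult.commute norm_eq_sqrt_inner flip: power2_eq_square)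
  then show ?thesis
    by (rule le_of_square_le) (simp_all add: C_nonneg)
qed

text \<open>The same argument with the Lipschitz dependence of \<open>v\<close> on the positions.
  The factor \<open>norm p\<close> remains, so at bounded energy the momenta can grow exponentially
  but not blow up.\<close>

lemma norm_gx_le: "norm (gx (x, p)) \<le> C * norm (v x p) * norm p"
proof -
  let ?g = "gx (x, p)"
  have "((\<lambda>k. H (k, p)) has_derivative (\<lambda>k. ?g \<bullet> k)) (at x)"
    using has_derivative_compose[OF has_derivative_Pair[OF has_derivative_ident has_derivative_const] H_deriv]
    by simp
  then have "\<bar>?g \<bullet> ?g\<bar> \<le> (norm (v x p) * C * norm p) * norm ?g"
  proof (rule has_derivative_bound)
    fix k
    have vk: "norm (v (x + k) p - v x p) \<le> C * norm k * norm p" by (rule norm_v_diff_le)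
    have "\<bar>H (x + k, p) - H (x, p)\<bar>
        \<le> norm (v x p) * norm (v (x + k) p - v x p) + (norm (v (x + k) p - v x p))\<^sup>2 / 2"
      unfolding H_eq using norm_sum_sq_bound[of "v x p" "v (x + k) p - v x p"] by simp
    also have "\<dots> \<le> norm (v x p) * (C * norm k * norm p) + (C * norm k * norm p)\<^sup>2 / 2"
      by (intro add_mono mult_left_mono divide_right_mono power_mono vk) auto
    finally show "\<bar>H (x + k, p) - H (x, p)\<bar>
        \<le> norm (v x p) * C * norm p * norm k + (C\<^sup>2 * (norm p)\<^sup>2 / 2) * (norm k)\<^sup>2"
      by (simp add: power_mult_distrib ac_simps)
  qed
  then have "norm ?g * norm ?g \<le> (C * norm (v x p) * norm p) * norm ?g"
    by (simp add: mult.commute mult.left_commute norm_eq_sqrt_inner flip: power2_eq_square)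
  then show ?thesis
    by (rule le_of_square_le) (simp_all add: C_nonneg)
qed

lemma H_nonneg: "0 \<le> H z"
  by (cases z) (simp add: H_eq)

text \<open>The regularised square root of the energy is the norm of a pair, which makes the
  triangle inequality available for it.\<close>

lemma sqrt_H: "sqrt (\<epsilon>\<^sup>2 + 2 * H (x, p)) = norm (\<epsilon>, v x p)"
  by (simp add: H_eq norm_Pair)

text \<open>\<open>A\<close> majorises the variation of \<open>P\<close>; in the application they
  are the primitives of \<open>norm (u s)\<close> and of \<open>u\<close>.\<close>

context
  fixes q0 :: "'b \<times> 'b" and P :: "real \<Rightarrow> 'b" and A :: "real \<Rightarrow> real" and \<tau> :: real
    and q :: "real \<Rightarrow> 'b \<times> 'b"
  assumes \<tau>: "0 \<le> \<tau>"
    and P: "continuous_on {0..\<tau>} P" "P 0 = 0"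
    and A: "continuous_on {0..\<tau>} A" "A 0 = 0"
    and PA: "\<forall>s\<in>{0..\<tau>}. \<forall>t\<in>{s..\<tau>}. norm (P t - P s) \<le> A t - A s"
    and sol: "integral_solution field (\<lambda>t. q0 + (0, P t)) \<tau> q"
begin

lemma continuous_q: "continuous_on {0..\<tau>} q"
  using sol by (simp add: integral_solution_def)

lemma continuous_field_q: "continuous_on {0..\<tau>} (\<lambda>s. field (q s))"
  by (rule integral_solution_continuous_rhs[OF continuous_q continuous_field])

lemma q_eq:
  assumes "t \<in> {0..\<tau>}"
  shows "fst (q t) = fst q0 + integral {0..t} (\<lambda>s. gp (q s))"
    and "snd (q t) = snd q0 + P t - integral {0..t} (\<lambda>s. gx (q s))"
proof -
  have "continuous_on {0..t} q"
    using continuous_q assms by (auto elim: continuous_on_subset)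
  note int = integral_field[OF this]
  have "q t = q0 + (0, P t) + integral {0..t} (\<lambda>s. field (q s))"
    using sol assms by (auto simp: integral_solution_def)
  then show "fst (q t) = fst q0 + integral {0..t} (\<lambda>s. gp (q s))"
    "snd (q t) = snd q0 + P t - integral {0..t} (\<lambda>s. gx (q s))"
    by (simp_all add: int)
qed

lemma continuous_gp_gx:
  "continuous_on {0..\<tau>} (\<lambda>s. gp (q s))" "continuous_on {0..\<tau>} (\<lambda>s. gx (q s))"
  using continuous_on_fst[OF continuous_field_q] continuous_on_minus[OF continuous_on_snd[OF continuous_field_q]]
  by (simp_all add: field_def)

text \<open>The momentum is not differentiable, so the energy is compared at each time \<open>s\<close> with its value
  along the curve obtained by freezing the control at time \<open>s\<close>; that curve is differentiable at \<open>s\<close>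
  and conserves the energy to first order there. The summand \<open>\<epsilon>\<close> keeps the square root smooth.\<close>

lemma energy_bound: "norm (v (fst (q \<tau>)) (snd (q \<tau>))) \<le> norm (v (fst q0) (snd q0)) + C * A \<tau>"
proof -
  define x where "x t = fst (q t)" for t
  define p where "p t = snd (q t)" for t
  have "sqrt (\<epsilon>\<^sup>2 + 2 * H (q \<tau>)) - C * A \<tau> \<le> sqrt (\<epsilon>\<^sup>2 + 2 * H (q 0)) - C * A 0" if \<epsilon>: "\<epsilon> > 0" for \<epsilon>
  proof (rule dini_nonincreasing[OF \<tau>])
    have "continuous_on UNIV H"
      by (intro continuous_at_imp_continuous_on ballI has_derivative_continuous[OF H_deriv])
    then have "continuous_on {0..\<tau>} (\<lambda>t. H (q t))"
      by (rule continuous_on_compose2[OF _ continuous_q]) simp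
    then show "continuous_on {0..\<tau>} (\<lambda>t. sqrt (\<epsilon>\<^sup>2 + 2 * H (q t)) - C * A t)"
      by (intro continuous_intros A)
    fix s \<eta> :: real assume s: "s \<in> {0..<\<tau>}" and \<eta>: "\<eta> > 0"
    define \<pi> where "\<pi> t = p t - (P t - P s)" for t
    define \<psi> where "\<psi> t = sqrt (\<epsilon>\<^sup>2 + 2 * H (x t, \<pi> t))" for t
    have s': "s \<in> {0..\<tau>}" using s by auto
    have "((\<lambda>t. fst q0 + integral {0..t} (\<lambda>s. gp (q s))) has_vector_derivative gp (q s)) (at s within {0..\<tau>})"
      using integral_has_vector_derivative[OF continuous_gp_gx(1) s']
      by (auto intro!: derivative_eq_intros)
    then have dx: "(x has_vector_derivative gp (q s)) (at s within {0..\<tau>})"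
      by (rule has_vector_derivative_transform[rotated 2]) (use s' q_eq(1) in \<open>auto simp: x_def\<close>)
    have "((\<lambda>t. snd q0 + P s - integral {0..t} (\<lambda>s. gx (q s))) has_vector_derivative (- gx (q s))) (at s within {0..\<tau>})"
      using integral_has_vector_derivative[OF continuous_gp_gx(2) s']
      by (auto intro!: derivative_eq_intros)
    then have d\<pi>: "(\<pi> has_vector_derivative (- gx (q s))) (at s within {0..\<tau>})"
      by (rule has_vector_derivative_transform[rotated 2]) (use s' q_eq(2) in \<open>auto simp: \<pi>_def p_def\<close>)
    have qs: "q s = (x s, \<pi> s)" by (simp add: x_def \<pi>_def p_def)
    \<comment> \<open>Both components move with the Hamiltonian field at time \<open>s\<close>, so
      the two inner products of \<open>gx\<close> and \<open>gp\<close> cancel.\<close>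
    have "((\<lambda>t. H (x t, \<pi> t)) has_derivative
        (\<lambda>h. gx (q s) \<bullet> fst (h *\<^sub>R gp (q s), h *\<^sub>R (- gx (q s))) + gp (q s) \<bullet> snd (h *\<^sub>R gp (q s), h *\<^sub>R (- gx (q s)))))
        (at s within {0..\<tau>})"
      using has_derivative_compose[OF has_derivative_Pair[OF dx[unfolded has_vector_derivative_def]
        d\<pi>[unfolded has_vector_derivative_def]] H_deriv] unfolding qs .
    then have dH: "((\<lambda>t. H (x t, \<pi> t)) has_real_derivative 0) (at s within {0..\<tau>})"
      by (simp add: has_field_derivative_def inner_commute flip: lambda_zero)
    have pos: "\<epsilon>\<^sup>2 + 2 * H (x s, \<pi> s) > 0" using \<epsilon> H_nonneg[of "(x s, \<pi> s)"] by (simp add: add_pos_nonneg)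
    have "((\<lambda>t. \<epsilon>\<^sup>2 + 2 * H (x t, \<pi> t)) has_real_derivative 0) (at s within {0..\<tau>})"
      by (rule derivative_eq_intros dH refl)+ simp
    from DERIV_chain2[OF DERIV_real_sqrt[OF pos] this]
    have "(\<psi> has_real_derivative 0) (at s within {0..\<tau>})" by (simp add: \<psi>_def[abs_def])
    from dini_has_real_derivative[OF this _ \<eta> s] obtain \<delta> where \<delta>: "\<delta> > 0"
      "\<And>t. t \<in> {s<..\<tau>} \<Longrightarrow> t < s + \<delta> \<Longrightarrow> \<psi> t - \<psi> s \<le> \<eta> * (t - s)" by auto
    have "sqrt (\<epsilon>\<^sup>2 + 2 * H (q t)) - C * A t - (sqrt (\<epsilon>\<^sup>2 + 2 * H (q s)) - C * A s) \<le> \<eta> * (t - s)"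
      if t: "t \<in> {s<..\<tau>}" "t < s + \<delta>" for t
    proof -
      \<comment> \<open>Actual and frozen momentum differ by \<open>P t - P s\<close>. Linearity of
        \<open>v (x t)\<close> bounds the effect by \<open>C * (A t - A s)\<close>, which is
        absorbed by the term \<open>C * A\<close> subtracted in the monotone quantity.\<close>
      have "v (x t) (p t) = v (x t) (\<pi> t) + v (x t) (P t - P s)"
        by (simp add: \<pi>_def flip: linear_add[OF linear_v])
      then have "norm (\<epsilon>, v (x t) (p t)) \<le> norm (\<epsilon>, v (x t) (\<pi> t)) + norm (0::real, v (x t) (P t - P s))"
        using norm_triangle_ineq[of "(\<epsilon>, v (x t) (\<pi> t))" "(0, v (x t) (P t - P s))"] by simp
      also have "norm (0::real, v (x t) (P t - P s)) = norm (v (x t) (P t - P s))"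
        by (simp add: norm_Pair)
      also have "\<dots> \<le> C * norm (P t - P s)" by (rule norm_v_le)
      also have "\<dots> \<le> C * (A t - A s)" using s t by (intro mult_left_mono PA[rule_format] C_nonneg) auto
      finally have "sqrt (\<epsilon>\<^sup>2 + 2 * H (q t)) \<le> \<psi> t + C * (A t - A s)"
        unfolding \<psi>_def sqrt_H using sqrt_H[of \<epsilon> "x t" "p t"] by (simp add: x_def p_def)
      moreover have "\<psi> s = sqrt (\<epsilon>\<^sup>2 + 2 * H (q s))" by (simp add: \<psi>_def qs)
      ultimately show ?thesis using \<delta>(2)[OF t] by (simp add: algebra_simps)
    qed
    then show "\<exists>\<delta>>0. \<forall>t\<in>{s<..\<tau>}. t < s + \<delta> \<longrightarrow>
        sqrt (\<epsilon>\<^sup>2 + 2 * H (q t)) - C * A t - (sqrt (\<epsilon>\<^sup>2 + 2 * H (q s)) - C * A s) \<le> \<eta> * (t - s)"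
      using \<delta>(1) by blast
  qed
  moreover have "q 0 = q0" using q_eq[of 0] \<tau> P(2) by (simp add: prod_eq_iff)
  ultimately have *: "norm (\<epsilon>, v (fst (q \<tau>)) (snd (q \<tau>))) \<le> norm (\<epsilon>, v (fst q0) (snd q0)) + C * A \<tau>"
    if "\<epsilon> > 0" for \<epsilon> :: real
    using that A(2) by (force simp flip: sqrt_H)
  show ?thesis
  proof (rule field_le_epsilon)
    fix \<epsilon> :: real assume \<epsilon>: "\<epsilon> > 0"
    have "norm (v (fst (q \<tau>)) (snd (q \<tau>))) \<le> norm (\<epsilon>, v (fst (q \<tau>)) (snd (q \<tau>)))"
      by (simp add: norm_Pair)
    also note *[OF \<epsilon>]
    also have "norm (\<epsilon>, v (fst q0) (snd q0)) \<le> norm \<epsilon> + norm (v (fst q0) (snd q0))"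
      by (rule norm_Pair_le)
    finally show "norm (v (fst (q \<tau>)) (snd (q \<tau>))) \<le> norm (v (fst q0) (snd q0)) + C * A \<tau> + \<epsilon>"
      using \<epsilon> by simp
  qed
qed

end

text \<open>The norm of the velocity field stays below \<open>N = C * (r + a)\<close>, so positions
  move with speed at most \<open>C * N\<close>, and the momenta satisfy Gronwall's inequality with
  rate \<open>C * N\<close> and constant \<open>r + a\<close>. The control enters only through
  \<open>a\<close>, a bound for its total mass, which makes the estimate uniform over L^2-bounded
  families.\<close>

lemma solution_bound:
  assumes \<tau>: "0 \<le> \<tau>" "\<tau> \<le> T"
    and P: "continuous_on {0..\<tau>} P" "P 0 = 0"
    and A: "continuous_on {0..\<tau>} A" "A 0 = 0"
    and PA: "\<forall>s\<in>{0..\<tau>}. \<forall>t\<in>{s..\<tau>}. norm (P t - P s) \<le> A t - A s"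
    and sol: "integral_solution field (\<lambda>t. q0 + (0, P t)) \<tau> q"
    and r: "norm q0 \<le> r" and a: "A \<tau> \<le> a"
  shows "norm (q \<tau>) \<le> r + T * C * (C * (r + a)) + (r + a) * exp (C * (C * (r + a)) * T)"
proof -
  define N where "N = C * (r + a)"
  have A_mono: "A s \<le> A t" if "0 \<le> s" "s \<le> t" "t \<le> \<tau>" for s t
    using PA that norm_ge_zero[of "P t - P s"] by (smt (verit) atLeastAtMost_iff)
  have ra: "0 \<le> r" "0 \<le> a" "0 \<le> N"
    using r norm_ge_zero[of q0] A_mono[of 0 \<tau>] A(2) a \<tau> C_nonneg
    by (auto simp: N_def simp del: norm_ge_zero intro!: mult_nonneg_nonneg)
  have q0: "norm (fst q0) \<le> r" "norm (snd q0) \<le> r"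
    using r norm_fst_le[of "fst q0" "snd q0"] norm_snd_le[of "snd q0" "fst q0"] by auto
  have sub: "{0..t} \<subseteq> {0..\<tau>}" if "t \<in> {0..\<tau>}" for t using that by auto
  have energy: "norm (v (fst (q t)) (snd (q t))) \<le> N" if t: "t \<in> {0..\<tau>}" for t
  proof -
    have "norm (v (fst (q t)) (snd (q t))) \<le> norm (v (fst q0) (snd q0)) + C * A t"
      by (rule energy_bound[of t P A])
         (use t P A PA continuous_on_subset[OF _ sub[OF t]] integral_solution_restrict[OF sol] in auto)
    also have "\<dots> \<le> C * r + C * a"
      using q0 t a A_mono[of t \<tau>] norm_v_le[of "fst q0" "snd q0"]
      by (intro add_mono mult_left_mono C_nonneg order_trans[OF norm_v_le]) auto
    finally show ?thesis by (simp add: N_def algebra_simps)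
  qed
  have gp_le: "norm (gp (q s)) \<le> C * N" if "s \<in> {0..\<tau>}" for s
    using norm_gp_le[of "fst (q s)" "snd (q s)"] mult_left_mono[OF energy[OF that] C_nonneg] by simp
  have gx_le: "norm (gx (q s)) \<le> C * N * norm (snd (q s))" if "s \<in> {0..\<tau>}" for s
    using norm_gx_le[of "fst (q s)" "snd (q s)"]
      mult_right_mono[OF mult_left_mono[OF energy[OF that] C_nonneg], of "norm (snd (q s))"] by simp
  note cont = continuous_gp_gx[OF \<tau>(1) P A PA sol] continuous_q[OF \<tau>(1) P A PA sol]
  note eq = q_eq[OF \<tau>(1) P A PA sol]
  have int: "f integrable_on {0..t}" if "continuous_on {0..\<tau>} f" "t \<in> {0..\<tau>}" for f :: "real \<Rightarrow> 'z::banach" and t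
    by (intro integrable_continuous_real continuous_on_subset[OF that(1)] sub that(2))
  have "norm (integral {0..\<tau>} (\<lambda>s. gp (q s))) \<le> integral {0..\<tau>} (\<lambda>s. C * N)"
    by (rule integral_norm_bound_integral) (use \<tau> gp_le int cont in auto)
  then have "norm (integral {0..\<tau>} (\<lambda>s. gp (q s))) \<le> \<tau> * (C * N)" using \<tau> by simp
  also have "\<dots> \<le> T * (C * N)" using \<tau> ra C_nonneg by (intro mult_right_mono) auto
  finally have x: "norm (fst (q \<tau>)) \<le> r + T * (C * N)"
    using eq(1)[of \<tau>] \<tau> q0(1) norm_triangle_ineq[of "fst q0" "integral {0..\<tau>} (\<lambda>s. gp (q s))"] by auto
  have "norm (snd (q \<tau>)) \<le> (r + a) * exp (C * N * \<tau>)"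
  proof (rule gronwall[OF \<tau>(1)])
    show cp: "continuous_on {0..\<tau>} (\<lambda>t. norm (snd (q t)))" by (intro continuous_intros cont)
    show "0 \<le> C * N" using ra C_nonneg by simp
    fix t assume t: "t \<in> {0..\<tau>}"
    have "norm (integral {0..t} (\<lambda>s. gx (q s))) \<le> integral {0..t} (\<lambda>s. C * N * norm (snd (q s)))"
    proof (rule integral_norm_bound_integral)
      show "(\<lambda>s. gx (q s)) integrable_on {0..t}" by (rule int[OF cont(2) t])
      show "(\<lambda>s. C * N * norm (snd (q s))) integrable_on {0..t}"
        by (rule int[OF continuous_on_mult_left[OF cp] t])
    qed (use t gx_le in auto)
    then have g: "norm (integral {0..t} (\<lambda>s. gx (q s))) \<le> C * N * integral {0..t} (\<lambda>s. norm (snd (q s)))"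
      by simp
    have "norm (P t) \<le> A t" using PA[rule_format, of 0 t] P(2) A(2) t by auto
    also have "\<dots> \<le> a" using A_mono[of t \<tau>] a t by auto
    finally have "norm (P t) \<le> a" .
    then show "norm (snd (q t)) \<le> r + a + C * N * integral {0..t} (\<lambda>s. norm (snd (q s)))"
      using eq(2)[OF t] g q0(2) norm_triangle_ineq4[of "snd q0 + P t" "integral {0..t} (\<lambda>s. gx (q s))"]
        norm_triangle_ineq[of "snd q0" "P t"] by simp
  qed
  also have "\<dots> \<le> (r + a) * exp (C * N * T)"
    using \<tau> ra C_nonneg by (intro mult_left_mono) (auto intro!: mult_left_mono)
  finally have "norm (snd (q \<tau>)) \<le> (r + a) * exp (C * N * T)" .
  then show ?thesis
    using x norm_Pair_le[of "fst (q \<tau>)" "snd (q \<tau>)"] by (simp add: N_def mult.assoc)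
qed

end

section \<open>Square-integrable controls\<close>

lemma L2_measurable: "u \<in> L2 T \<Longrightarrow> u \<in> borel_measurable (lebesgue_on {0..T})"
  by (simp add: L2_def)

lemma L2_norm_square: "u \<in> L2 T \<Longrightarrow> integrable (lebesgue_on {0..T}) (\<lambda>t. (norm (u t))\<^sup>2)"
  by (simp add: L2_def)

lemma L2_integrable:
  assumes "u \<in> L2 T"
  shows "integrable (lebesgue_on {0..T}) u"
proof (rule Bochner_Integration.integrable_bound)
  show "integrable (lebesgue_on {0..T}) (\<lambda>t. 1 + (norm (u t))\<^sup>2)"
    using L2_norm_square[OF assms] by (intro Bochner_Integration.integrable_add) auto
  have "y \<le> 1 + y\<^sup>2" for y :: real
    using zero_le_power2[of "y - 1/2"] by (simp add: power2_eq_square algebra_simps)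
  then show "AE t in lebesgue_on {0..T}. norm (u t) \<le> norm (1 + (norm (u t))\<^sup>2)"
    by (intro AE_I2) simp
qed (rule L2_measurable[OF assms])

lemma L2_scaleR:
  assumes "u \<in> L2 T"
  shows "(\<lambda>t. a *\<^sub>R u t) \<in> L2 T"
  using assms by (auto simp: L2_def power_mult_distrib)

lemma L2_add:
  assumes "u \<in> L2 T" "w \<in> L2 T"
  shows "(\<lambda>t. u t + w t) \<in> L2 T"
proof -
  let ?M = "lebesgue_on {0..T}"
  have m: "u \<in> borel_measurable ?M" "w \<in> borel_measurable ?M" using assms by (auto dest: L2_measurable)
  have "integrable ?M (\<lambda>t. (norm (u t + w t))\<^sup>2)"
  proof (rule Bochner_Integration.integrable_bound)
    show "integrable ?M (\<lambda>t. 2 * (norm (u t))\<^sup>2 + 2 * (norm (w t))\<^sup>2)"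
      using L2_norm_square[OF assms(1)] L2_norm_square[OF assms(2)]
      by (intro Bochner_Integration.integrable_add Bochner_Integration.integrable_mult_right)
    show "(\<lambda>t. (norm (u t + w t))\<^sup>2) \<in> borel_measurable ?M" using m by measurable
    have "(norm (a + b))\<^sup>2 \<le> 2 * (norm a)\<^sup>2 + 2 * (norm b)\<^sup>2" for a b :: 'a
    proof -
      have "(norm (a + b))\<^sup>2 \<le> (norm a + norm b)\<^sup>2" by (intro power_mono norm_triangle_ineq) auto
      also have "\<dots> \<le> 2 * (norm a)\<^sup>2 + 2 * (norm b)\<^sup>2"
        using zero_le_power2[of "norm a - norm b"] by (simp add: power2_sum power2_diff)
      finally show ?thesis .
    qed
    then show "AE t in ?M. norm ((norm (u t + w t))\<^sup>2) \<le> norm (2 * (norm (u t))\<^sup>2 + 2 * (norm (w t))\<^sup>2)"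
      by (intro AE_I2) simp
  qed
  then show ?thesis using m by (auto simp: L2_def)
qed

lemma L2_diff: "u \<in> L2 T \<Longrightarrow> w \<in> L2 T \<Longrightarrow> (\<lambda>t. u t - w t) \<in> L2 T"
  using L2_add[OF _ L2_scaleR[of w T "-1"], of u] by simp

text \<open>Solutions are handled with gauge integrals over \<open>{0..t}\<close>, the functional
  with Lebesgue integrals over \<open>{0..T}\<close>; the form with the indicator lets limits be
  taken in one fixed measure space.\<close>

lemma integrable_lebesgue_on_initial:
  fixes u :: "real \<Rightarrow> 'a::euclidean_space"
  assumes "integrable (lebesgue_on {0..T}) u" "t \<in> {0..T}"
  shows "integrable (lebesgue_on {0..t}) u"
    and "integral\<^sup>L (lebesgue_on {0..t}) u = integral {0..t} u"
    and "integral {0..t} u = (LINT s|lebesgue_on {0..T}. indicator {0..t} s *\<^sub>R u s)"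
proof -
  have "{0..t} = {0..t} \<inter> {0..T}" using assms by auto
  then have ind: "indicator {0..t} s *\<^sub>R u s = indicator {0..T} s *\<^sub>R (indicator {0..t} s *\<^sub>R u s)" for s
    by (auto simp: indicator_def)
  show i: "integrable (lebesgue_on {0..t}) u"
  proof -
    have "integrable lebesgue (\<lambda>s. indicator {0..t} s *\<^sub>R (indicator {0..T} s *\<^sub>R u s))"
      by (intro integrable_mult_indicator iffD1[OF integrable_restrict_space assms(1)]) auto
    also have "(\<lambda>s. indicator {0..t} s *\<^sub>R (indicator {0..T} s *\<^sub>R u s)) = (\<lambda>s. indicator {0..t} s *\<^sub>R u s)"
      using assms(2) by (auto simp: indicator_def fun_eq_iff)
    finally show ?thesis by (simp add: integrable_restrict_space)
  qed
  show eq: "integral\<^sup>L (lebesgue_on {0..t}) u = integral {0..t} u"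
    by (rule lebesgue_integral_eq_integral[OF i]) auto
  have "integral\<^sup>L (lebesgue_on {0..t}) u = (LINT s|lebesgue. indicator {0..t} s *\<^sub>R u s)"
    by (simp add: integral_restrict_space)
  also have "\<dots> = (LINT s|lebesgue. indicator {0..T} s *\<^sub>R (indicator {0..t} s *\<^sub>R u s))"
    by (simp only: ind[symmetric])
  also have "\<dots> = (LINT s|lebesgue_on {0..T}. indicator {0..t} s *\<^sub>R u s)"
    by (simp add: integral_restrict_space)
  finally show "integral {0..t} u = (LINT s|lebesgue_on {0..T}. indicator {0..t} s *\<^sub>R u s)"
    using eq by simp
qed

text \<open>Fatou's lemma. Integrability of the limit belongs to the conclusion because the limit
  control is not yet known to be square integrable when this is applied.\<close>

lemma integral_le_of_AE_limit:
  fixes f :: "nat \<Rightarrow> 'a \<Rightarrow> real"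
  assumes f: "\<And>k. integrable M (f k)" "\<And>k x. x \<in> space M \<Longrightarrow> 0 \<le> f k x"
    and g: "g \<in> borel_measurable M" "\<And>x. x \<in> space M \<Longrightarrow> 0 \<le> g x"
    and lim: "AE x in M. (\<lambda>k. f k x) \<longlonglongrightarrow> g x"
    and b: "\<And>k. integral\<^sup>L M (f k) \<le> b k" "b \<longlonglongrightarrow> l"
  shows "integrable M g \<and> integral\<^sup>L M g \<le> l"
proof -
  have "0 \<le> b k" for k
    by (rule order_trans[OF Bochner_Integration.integral_nonneg b(1)]) (rule f(2))
  then have l: "0 \<le> l" using b(2) by (intro LIMSEQ_le_const[of b]) auto
  have "(\<integral>\<^sup>+x. ennreal (g x) \<partial>M) = (\<integral>\<^sup>+x. liminf (\<lambda>k. ennreal (f k x)) \<partial>M)"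
  proof (rule nn_integral_cong_AE, use lim in eventually_elim)
    fix x assume "(\<lambda>k. f k x) \<longlonglongrightarrow> g x"
    then have "(\<lambda>k. ennreal (f k x)) \<longlonglongrightarrow> ennreal (g x)" by (rule tendsto_ennrealI)
    then show "ennreal (g x) = liminf (\<lambda>k. ennreal (f k x))"
      by (simp add: lim_imp_Liminf)
  qed
  also have "\<dots> \<le> liminf (\<lambda>k. \<integral>\<^sup>+x. ennreal (f k x) \<partial>M)"
    by (rule nn_integral_liminf) (use f in auto)
  also have "\<dots> \<le> liminf (\<lambda>k. ennreal (b k))"
  proof (intro Liminf_mono always_eventually allI)
    fix k
    have "(\<integral>\<^sup>+x. ennreal (f k x) \<partial>M) = ennreal (integral\<^sup>L M (f k))"
      by (rule nn_integral_eq_integral) (use f in auto)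
    also have "\<dots> \<le> ennreal (b k)" by (rule ennreal_leI[OF b(1)])
    finally show "(\<integral>\<^sup>+x. ennreal (f k x) \<partial>M) \<le> ennreal (b k)" .
  qed
  also have "\<dots> = ennreal l"
    using tendsto_ennrealI[OF b(2)] by (simp add: lim_imp_Liminf)
  finally have *: "(\<integral>\<^sup>+x. ennreal (g x) \<partial>M) \<le> ennreal l" .
  then have i: "integrable M g"
    by (intro integrableI_nonneg g AE_I2) (auto simp: order_le_less_trans)
  then have "ennreal (integral\<^sup>L M g) \<le> ennreal l"
    using * nn_integral_eq_integral[OF i] g(2) by auto
  then show ?thesis using i l by (simp add: ennreal_le_iff)
qed

text \<open>The rate 1/4 suits squared L^2 distances: the distances themselves then decay like
  \<open>(1/2) ^ i\<close>.\<close>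

lemma subseq_geometric_bound:
  fixes r :: "nat \<Rightarrow> real"
  assumes "r \<longlonglongrightarrow> 0"
  obtains k where "strict_mono k" "\<And>i. r (k i) \<le> (1/4) ^ i"
proof -
  have ex: "\<exists>N>m. r N \<le> (1/4) ^ i" for m i :: nat
  proof -
    have "\<forall>\<^sub>F n in sequentially. r n < (1/4) ^ i \<and> n > m"
      by (intro eventually_conj order_tendstoD(2)[OF assms] eventually_gt_at_top) auto
    then show ?thesis
      using eventually_happens'[OF trivial_limit_sequentially] less_imp_le by fast
  qed
  have "\<exists>k. \<forall>i. r (k i) \<le> (1/4) ^ i \<and> k i < k (Suc i)"
  proof (rule dependent_nat_choice)
    show "\<exists>n. r n \<le> (1/4) ^ 0" using ex[of 0 0] by auto
    show "\<exists>m. r m \<le> (1/4) ^ Suc i \<and> n < m" for n i using ex[of n "Suc i"] by auto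
  qed
  then obtain k where "\<forall>i. r (k i) \<le> (1/4) ^ i \<and> k i < k (Suc i)" by blast
  then show ?thesis by (intro that[of k]) (auto simp: strict_mono_Suc_iff)
qed

text \<open>The Riesz-Fischer argument: increments along a fast subsequence are summable in L^1,
  which gives convergence almost everywhere and, by integrating the series term by term, convergence
  of the primitives. Square integrability of \<open>z\<close> is left to the coercivity of the
  functional.\<close>

lemma L2_Cauchy_limit:
  fixes w :: "nat \<Rightarrow> real \<Rightarrow> 'a::euclidean_space"
  assumes T: "0 \<le> T" and w: "\<And>k. w k \<in> L2 T" and r: "r \<longlonglongrightarrow> 0"
    and le: "\<And>k j. k \<le> j \<Longrightarrow> (LINT s|lebesgue_on {0..T}. (norm (w j s - w k s))\<^sup>2) \<le> r k"
  obtains k z where "strict_mono k" "integrable (lebesgue_on {0..T}) z"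
    "AE s in lebesgue_on {0..T}. (\<lambda>i. w (k i) s) \<longlonglongrightarrow> z s"
    "\<And>t. t \<in> {0..T} \<Longrightarrow> (\<lambda>i. integral {0..t} (w (k i))) \<longlonglongrightarrow> integral {0..t} z"
proof -
  let ?M = "lebesgue_on {0..T}"
  obtain k where k: "strict_mono k" "\<And>i. r (k i) \<le> (1/4) ^ i"
    by (rule subseq_geometric_bound[OF r]) (rule that)
  define f where "f i s = w (k (Suc i)) s - w (k i) s" for i s
  have f2: "f i \<in> L2 T" for i unfolding f_def by (intro L2_diff w)
  have fi: "integrable ?M (f i)" for i by (rule L2_integrable[OF f2])
  have fle: "(LINT s|?M. norm (f i s)) \<le> (T + 1) / 2 * (1/2) ^ i" for i
  proof -
    \<comment> \<open>The weight \<open>2 ^ i\<close> balances the two terms: the squared norms are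
      at most \<open>(1/4) ^ i\<close>, so both contributions are of order
      \<open>(1/2) ^ i\<close>.\<close>
    have amgm: "y \<le> (1/2) * (1/2) ^ i + (1/2) * 2 ^ i * y\<^sup>2" for y :: real
    proof -
      have "0 \<le> (1 - 2 ^ i * y)\<^sup>2" by simp
      then have "2 * (2 ^ i * y) \<le> 1 + (2 ^ i * y)\<^sup>2" by (simp add: power2_diff)
      then have "(1/2) ^ (i + 1) * (2 * (2 ^ i * y)) \<le> (1/2) ^ (i + 1) * (1 + (2 ^ i * y)\<^sup>2)"
        by (intro mult_left_mono) auto
      moreover have "(1/2::real) ^ i * 2 ^ i = 1" by (simp flip: power_mult_distrib)
      ultimately show ?thesis by (simp add: algebra_simps power2_eq_square)
    qed
    have "(LINT s|?M. norm (f i s)) \<le> (LINT s|?M. (1/2) * (1/2) ^ i + (1/2) * 2 ^ i * (norm (f i s))\<^sup>2)"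
      using L2_norm_square[OF f2]
      by (intro integral_mono integrable_norm fi amgm Bochner_Integration.integrable_add) auto
    also have "\<dots> = (1/2) * (1/2) ^ i * T + (1/2) * 2 ^ i * (LINT s|?M. (norm (f i s))\<^sup>2)"
      using L2_norm_square[OF f2[of i]] T
      by (subst Bochner_Integration.integral_add) (auto simp: measure_restrict_space)
    also have "\<dots> \<le> (1/2) * (1/2) ^ i * T + (1/2) * 2 ^ i * (1/4) ^ i"
      using le[of "k i" "k (Suc i)"] k strict_mono_less_eq[OF k(1), of i "Suc i"]
      by (intro add_left_mono mult_left_mono) (auto simp: f_def intro: order_trans)
    also have "\<dots> = (1/2) * (1/2) ^ i * T + (1/2) * (2 ^ i * (1/4) ^ i)"
      by (simp only: mult.assoc)
    also have "(2::real) ^ i * (1/4) ^ i = (1/2) ^ i" by (simp flip: power_mult_distrib)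
    also have "(1/2) * (1/2) ^ i * T + (1/2) * (1/2) ^ i = (T + 1) / 2 * (1/2) ^ i"
      by (simp add: distrib_right)
    finally show ?thesis .
  qed
  have sum: "summable (\<lambda>i. LINT s|?M. norm (f i s))"
  proof (rule summable_comparison_test)
    show "\<exists>N. \<forall>n\<ge>N. norm (LINT s|?M. norm (f n s)) \<le> (T + 1) / 2 * (1/2) ^ n" using fle by auto
    show "summable (\<lambda>n. (T + 1) / 2 * (1/2::real) ^ n)" by (intro summable_mult summable_geometric) auto
  qed
  have AE: "AE s in ?M. summable (\<lambda>i. norm (f i s))"
  proof -
    have m: "(\<lambda>s. ennreal (norm (f i s))) \<in> borel_measurable ?M" for i
      using L2_measurable[OF f2[of i]] by measurable
    have "(\<integral>\<^sup>+s. (\<Sum>i. ennreal (norm (f i s))) \<partial>?M) = (\<Sum>i. \<integral>\<^sup>+s. ennreal (norm (f i s)) \<partial>?M)"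
      by (rule nn_integral_suminf[OF m])
    also have "\<dots> = (\<Sum>i. ennreal (LINT s|?M. norm (f i s)))"
      by (intro arg_cong[where f = suminf] ext nn_integral_eq_integral integrable_norm fi) auto
    also have "\<dots> \<noteq> \<infinity>"
      unfolding infinity_ennreal_def by (rule ennreal_suminf_neq_top[OF sum]) simp
    finally have "AE s in ?M. (\<Sum>i. ennreal (norm (f i s))) \<noteq> \<infinity>"
      by (intro nn_integral_PInf_AE borel_measurable_suminf_order m) auto
    then show ?thesis
      by eventually_elim (auto intro!: summable_suminf_not_top)
  qed
  \<comment> \<open>Where the series diverges, which is on a null set, \<open>suminf\<close> has an
    arbitrary value; neither integrals nor limits almost everywhere are affected.\<close>
  define z where "z s = w (k 0) s + (\<Sum>i. f i s)" for s
  have tel: "w (k n) s = w (k 0) s + (\<Sum>i<n. f i s)" for n s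
    unfolding f_def by (subst sum_lessThan_telescope[of "\<lambda>i. w (k i) s"]) simp
  have fsi: "integrable ?M (\<lambda>s. \<Sum>i. f i s)" by (rule integrable_suminf[OF fi AE sum])
  have zi: "integrable ?M z"
    unfolding z_def by (intro Bochner_Integration.integrable_add L2_integrable w fsi)
  have lim: "AE s in ?M. (\<lambda>i. w (k i) s) \<longlonglongrightarrow> z s"
    using AE
  proof eventually_elim
    case (elim s)
    then have "(\<lambda>n. w (k 0) s + (\<Sum>i<n. f i s)) \<longlonglongrightarrow> z s"
      unfolding z_def by (intro tendsto_add tendsto_const summable_LIMSEQ[OF summable_norm_cancel])
    then show ?case by (simp flip: tel)
  qed
  have "(\<lambda>i. integral {0..t} (w (k i))) \<longlonglongrightarrow> integral {0..t} z" if t: "t \<in> {0..T}" for t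
  proof -
    let ?\<chi> = "indicator {0..t} :: real \<Rightarrow> real"
    note eq = integrable_lebesgue_on_initial(3)[OF _ t]
    have i: "integrable ?M (\<lambda>s. ?\<chi> s *\<^sub>R f i s)" for i
      by (intro integrable_mult_indicator fi) (use t in \<open>auto simp: sets_restrict_space_iff\<close>)
    have chi_sum: "(\<Sum>i. ?\<chi> s *\<^sub>R f i s) = ?\<chi> s *\<^sub>R (\<Sum>i. f i s)" for s
      by (cases "s \<in> {0..t}") auto
    have "(\<lambda>i. LINT s|?M. ?\<chi> s *\<^sub>R f i s) sums (LINT s|?M. (\<Sum>i. ?\<chi> s *\<^sub>R f i s))"
    proof (rule sums_integral[OF i])
      show "AE s in ?M. summable (\<lambda>i. norm (?\<chi> s *\<^sub>R f i s))"
        using AE by eventually_elim (auto intro: summable_mult)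
      show "summable (\<lambda>i. LINT s|?M. norm (?\<chi> s *\<^sub>R f i s))"
      proof (rule summable_comparison_test[OF _ sum], intro exI allI impI)
        fix n
        have "(LINT s|?M. norm (?\<chi> s *\<^sub>R f n s)) \<le> (LINT s|?M. norm (f n s))"
          by (intro integral_mono integrable_norm i fi) (auto simp: indicator_def)
        then show "norm (LINT s|?M. norm (?\<chi> s *\<^sub>R f n s)) \<le> (LINT s|?M. norm (f n s))" by simp
      qed
    qed
    then have "(\<lambda>i. integral {0..t} (f i)) sums integral {0..t} (\<lambda>s. \<Sum>i. f i s)"
      by (simp add: eq[OF fi] eq[OF fsi] chi_sum)
    then have "(\<lambda>n. integral {0..t} (w (k 0)) + (\<Sum>i<n. integral {0..t} (f i)))
        \<longlonglongrightarrow> integral {0..t} (w (k 0)) + integral {0..t} (\<lambda>s. \<Sum>i. f i s)"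
      unfolding sums_def by (intro tendsto_intros)
    moreover have io: "g integrable_on {0..t}" if "integrable ?M g" for g :: "real \<Rightarrow> 'a"
      using integrable_lebesgue_on_initial(1)[OF that t] by (intro integrable_on_lebesgue_on) auto
    moreover have "integral {0..t} (w (k 0)) + (\<Sum>i<n. integral {0..t} (f i)) = integral {0..t} (w (k n))" for n
      unfolding f_def
      by (simp add: integral_diff io L2_integrable w sum_lessThan_telescope[of "\<lambda>i. integral {0..t} (w (k i))"])
    moreover have "integral {0..t} (w (k 0)) + integral {0..t} (\<lambda>s. \<Sum>i. f i s) = integral {0..t} z"
      unfolding z_def by (simp add: integral_add io L2_integrable w fsi)
    ultimately show ?thesis by simp
  qed
  then show ?thesis using that k(1) zi lim by blast
qed

text \<open>The set of controls whose primitive is close to \<open>U\<close> is convex, so near-minimisers of the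
  quadratic functional on shrinking such sets form a Cauchy sequence by the parallelogram identity;
  this replaces weak compactness and weak lower semicontinuity in \<open>L\<^sup>2\<close>.\<close>

lemma L2_quadratic_lower_semicontinuity:
  fixes Q :: "real \<Rightarrow> 'b::euclidean_space \<Rightarrow> real" and u :: "nat \<Rightarrow> real \<Rightarrow> 'b"
  assumes T: "0 \<le> T" and c: "c > 0"
    and Q_measurable: "\<And>w. w \<in> borel_measurable (lebesgue_on {0..T}) \<Longrightarrow>
      (\<lambda>s. Q s (w s)) \<in> borel_measurable (lebesgue_on {0..T})"
    and Q_integrable: "\<And>w. w \<in> L2 T \<Longrightarrow> integrable (lebesgue_on {0..T}) (\<lambda>s. Q s (w s))"
    and parallelogram: "\<And>s a b. s \<in> {0..T} \<Longrightarrow>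
      Q s ((1/2) *\<^sub>R (a + b)) + Q s ((1/2) *\<^sub>R (a - b)) = (Q s a + Q s b) / 2"
    and coercive: "\<And>s a. s \<in> {0..T} \<Longrightarrow> c * (norm a)\<^sup>2 \<le> Q s a"
    and continuous: "\<And>s. s \<in> {0..T} \<Longrightarrow> continuous_on UNIV (Q s)"
    and u: "\<And>m. u m \<in> L2 T"
    and U: "\<And>e. e > 0 \<Longrightarrow> \<forall>\<^sub>F m in sequentially. \<forall>t\<in>{0..T}. norm (integral {0..t} (u m) - U t) \<le> e"
    and l: "(\<lambda>m. LINT s|lebesgue_on {0..T}. Q s (u m s)) \<longlonglongrightarrow> l"
  shows "\<exists>w\<in>L2 T. (\<forall>t\<in>{0..T}. integral {0..t} w = U t) \<and>
    (LINT s|lebesgue_on {0..T}. Q s (w s)) \<le> l"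
proof -
  let ?M = "lebesgue_on {0..T}"
  have Q_nonneg: "0 \<le> Q s a" if "s \<in> {0..T}" for s a
    using coercive[OF that, of a] c by (meson less_imp_le mult_nonneg_nonneg order_trans zero_le_power2)
  define I where "I w = (LINT s|?M. Q s (w s))" for w
  have I_nonneg: "0 \<le> I w" for w
    unfolding I_def by (rule Bochner_Integration.integral_nonneg) (use Q_nonneg in auto)
  \<comment> \<open>The tolerances shrink these sets towards the controls with primitive exactly
    \<open>U\<close>, while each set still contains all but finitely many of the given
    controls.\<close>
  define S where "S k = {w \<in> L2 T. \<forall>t\<in>{0..T}. norm (integral {0..t} w - U t) \<le> 1 / real (Suc k)}" for k
  have io: "w integrable_on {0..t}" if "w \<in> L2 T" "t \<in> {0..T}" for w :: "real \<Rightarrow> 'b" and t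
    using integrable_lebesgue_on_initial(1)[OF L2_integrable that(2)] that
    by (intro integrable_on_lebesgue_on) auto
  have S_mono: "S j \<subseteq> S k" if "k \<le> j" for k j
  proof -
    have "1 / real (Suc j) \<le> 1 / real (Suc k)" using that by (simp add: frac_le)
    then show ?thesis unfolding S_def by (auto intro: order_trans)
  qed
  have S_mid: "(\<lambda>s. (1/2) *\<^sub>R (a s + b s)) \<in> S k" if ab: "a \<in> S k" "b \<in> S k" for a b k
  proof -
    have L: "a \<in> L2 T" "b \<in> L2 T" using ab by (auto simp: S_def)
    have "norm (integral {0..t} (\<lambda>s. (1/2) *\<^sub>R (a s + b s)) - U t) \<le> 1 / real (Suc k)" if t: "t \<in> {0..T}" for t
    proof -
      have "integral {0..t} (\<lambda>s. (1/2) *\<^sub>R (a s + b s)) - U t =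
          (1/2) *\<^sub>R (integral {0..t} a - U t) + (1/2) *\<^sub>R (integral {0..t} b - U t)"
        by (simp add: integral_add io[OF _ t] L algebra_simps flip: scaleR_add_left)
      also have "norm \<dots> \<le> (1/2) * norm (integral {0..t} a - U t) + (1/2) * norm (integral {0..t} b - U t)"
        by (rule order_trans[OF norm_triangle_ineq]) simp
      also have "\<dots> \<le> (1/2) * (1 / real (Suc k)) + (1/2) * (1 / real (Suc k))"
        using ab t by (intro add_mono mult_left_mono) (auto simp: S_def)
      also have "\<dots> = 1 / real (Suc k)" by (simp add: field_simps)
      finally show ?thesis .
    qed
    then show ?thesis unfolding S_def using L by (auto intro!: L2_scaleR L2_add)
  qed
  have u_S: "\<forall>\<^sub>F m in sequentially. u m \<in> S k" for k
    using U[of "1 / real (Suc k)"] u by (auto simp: S_def elim: eventually_mono)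
  have S_ne: "S k \<noteq> {}" for k
    using eventually_happens'[OF trivial_limit_sequentially u_S[of k]] by auto
  \<comment> \<open>Infima over shrinking sets increase, and the given controls keep them below
    \<open>l\<close>; their limit \<open>D\<close> will bound the value at the limit
    control.\<close>
  define d where "d k = Inf (I ` S k)" for k
  have bdd: "bdd_below (I ` S k)" for k
    using I_nonneg by (auto intro!: bdd_belowI[of _ 0])
  have d_le: "d k \<le> I w" if "w \<in> S k" for k w
    unfolding d_def by (rule cInf_lower[OF _ bdd]) (use that in auto)
  have d_mono: "d k \<le> d j" if "k \<le> j" for k j
    unfolding d_def by (rule cInf_superset_mono[OF _ bdd]) (use S_ne S_mono[OF that] in auto)
  have d_l: "d k \<le> l" for k
  proof (rule tendsto_lowerbound[OF l])
    show "\<forall>\<^sub>F m in sequentially. d k \<le> (LINT s|?M. Q s (u m s))"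
      using u_S[of k] by eventually_elim (use d_le in \<open>auto simp: I_def\<close>)
  qed auto
  obtain D where D: "d \<longlonglongrightarrow> D" "\<And>k. d k \<le> D"
    using incseq_convergent[of d l] d_mono d_l by (auto simp: incseq_def)
  have Dl: "D \<le> l" using D(1) d_l by (intro LIMSEQ_le_const2[of d]) auto
  have "\<exists>w\<in>S k. I w < d k + 1 / real (Suc k)" for k
    using cInf_lessD[of "I ` S k" "d k + 1 / real (Suc k)"] S_ne[of k] by (auto simp: d_def)
  then obtain w where w: "\<And>k. w k \<in> S k" "\<And>k. I (w k) < d k + 1 / real (Suc k)" by metis
  have w2: "w k \<in> L2 T" for k using w(1)[of k] by (auto simp: S_def)
  \<comment> \<open>For \<open>k \<le> j\<close> the midpoint of \<open>w j\<close> and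
    \<open>w k\<close> lies in \<open>S k\<close>, so its value is at least \<open>d k\<close>, and
    the parallelogram identity leaves at most \<open>(D - d k) / 2 + 1 / real (Suc k)\<close> for
    half the difference. Coercivity applied to that half contributes the factor
    \<open>4 / c\<close>.\<close>
  define r where "r k = 4 / c * ((D - d k) / 2 + 1 / real (Suc k))" for k
  have "r \<longlonglongrightarrow> 4 / c * ((D - D) / 2 + 0)"
    unfolding r_def by (intro tendsto_intros D LIMSEQ_Suc[OF lim_1_over_n]) auto
  then have r: "r \<longlonglongrightarrow> 0" by simp
  have Cauchy: "(LINT s|?M. (norm (w j s - w k s))\<^sup>2) \<le> r k" if kj: "k \<le> j" for k j
  proof -
    let ?a = "\<lambda>s. (1/2) *\<^sub>R (w j s + w k s)" and ?b = "\<lambda>s. (1/2) *\<^sub>R (w j s - w k s)"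
    have wj: "w j \<in> S k" using w(1)[of j] S_mono[OF kj] by blast
    have aS: "?a \<in> S k" by (rule S_mid[OF wj w(1)])
    have L: "?a \<in> L2 T" "?b \<in> L2 T" by (intro L2_scaleR L2_add L2_diff w2)+
    have "I ?a + I ?b = (LINT s|?M. Q s (?a s) + Q s (?b s))"
      unfolding I_def using Q_integrable[OF L(1)] Q_integrable[OF L(2)] by simp
    also have "\<dots> = (LINT s|?M. (Q s (w j s) + Q s (w k s)) / 2)"
      by (rule Bochner_Integration.integral_cong) (use parallelogram in auto)
    also have "\<dots> = (I (w j) + I (w k)) / 2"
      unfolding I_def using Q_integrable[OF w2] by simp
    finally have sum: "I ?a + I ?b = (I (w j) + I (w k)) / 2" .
    have "1 / real (Suc j) \<le> 1 / real (Suc k)" using kj by (simp add: frac_le)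
    moreover have "b \<le> (D - d k) / 2 + \<epsilon>"
      if "\<epsilon>' \<le> \<epsilon>" "a + b = (x + y) / 2" "d k \<le> a" "x < d j + \<epsilon>'" "y < d k + \<epsilon>" for a b x y \<epsilon> \<epsilon>'
      using that D(2)[of j] by argo
    ultimately have Ib: "I ?b \<le> (D - d k) / 2 + 1 / real (Suc k)"
      using sum d_le[OF aS] w(2)[of j] w(2)[of k] by blast
    have "c / 4 * (LINT s|?M. (norm (w j s - w k s))\<^sup>2) = (LINT s|?M. c * (norm (?b s))\<^sup>2)"
      by (simp add: power_divide)
    also have "\<dots> \<le> I ?b"
      unfolding I_def
      by (intro integral_mono Q_integrable L Bochner_Integration.integrable_mult_right L2_norm_square
          coercive) simp
    finally have "(LINT s|?M. (norm (w j s - w k s))\<^sup>2) \<le> 4 / c * I ?b"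
      using c by (simp add: field_simps)
    also have "\<dots> \<le> r k" unfolding r_def using c by (intro mult_left_mono Ib) auto
    finally show ?thesis .
  qed
  obtain k z where k: "strict_mono k" and z: "integrable ?M z"
    and lim: "AE s in ?M. (\<lambda>i. w (k i) s) \<longlonglongrightarrow> z s"
    and prim: "\<And>t. t \<in> {0..T} \<Longrightarrow> (\<lambda>i. integral {0..t} (w (k i))) \<longlonglongrightarrow> integral {0..t} z"
    by (rule L2_Cauchy_limit[OF T w2 r]) (erule Cauchy, rule that)
  have zm: "z \<in> borel_measurable ?M" using z by auto
  \<comment> \<open>Fatou's lemma along the subsequence converging almost everywhere; continuity of
    each \<open>Q s\<close> carries the convergence over to the integrands.\<close>
  have "integrable ?M (\<lambda>s. Q s (z s)) \<and> (LINT s|?M. Q s (z s)) \<le> D"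
  proof (rule integral_le_of_AE_limit)
    show "AE s in ?M. (\<lambda>i. Q s (w (k i) s)) \<longlonglongrightarrow> Q s (z s)"
    proof (use lim AE_space in eventually_elim)
      fix s assume s: "s \<in> space ?M" "(\<lambda>i. w (k i) s) \<longlonglongrightarrow> z s"
      then have "isCont (Q s) (z s)"
        using continuous[of s] by (auto simp: continuous_on_eq_continuous_at)
      then show "(\<lambda>i. Q s (w (k i) s)) \<longlonglongrightarrow> Q s (z s)"
        using s(2) by (rule isCont_tendsto_compose)
    qed
    show "(LINT s|?M. Q s (w (k i) s)) \<le> d (k i) + 1 / real (Suc (k i))" for i
      using w(2)[of "k i"] by (simp add: I_def)
    have "(\<lambda>k. d k + 1 / real (Suc k)) \<longlonglongrightarrow> D + 0"
      by (intro tendsto_intros D LIMSEQ_Suc[OF lim_1_over_n])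
    from LIMSEQ_subseq_LIMSEQ[OF this k]
    show "(\<lambda>i. d (k i) + 1 / real (Suc (k i))) \<longlonglongrightarrow> D" by (simp add: o_def)
  qed (use Q_integrable w2 Q_nonneg Q_measurable zm in auto)
  then have Qz: "integrable ?M (\<lambda>s. Q s (z s))" "(LINT s|?M. Q s (z s)) \<le> D" by auto
  have "integrable ?M (\<lambda>s. (norm (z s))\<^sup>2)"
  proof (rule Bochner_Integration.integrable_bound)
    show "integrable ?M (\<lambda>s. Q s (z s) / c)" using Qz(1) by simp
    show "(\<lambda>s. (norm (z s))\<^sup>2) \<in> borel_measurable ?M" using zm by measurable
    show "AE s in ?M. norm ((norm (z s))\<^sup>2) \<le> norm (Q s (z s) / c)"
      using coercive Q_nonneg c by (intro AE_I2) (auto simp: pos_le_divide_eq mult.commute)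
  qed
  then have "z \<in> L2 T" using zm by (simp add: L2_def)
  moreover have "integral {0..t} z = U t" if t: "t \<in> {0..T}" for t
  proof -
    have "(\<lambda>i. norm (integral {0..t} (w (k i)) - U t)) \<longlonglongrightarrow> norm (integral {0..t} z - U t)"
      by (intro tendsto_intros prim t)
    moreover have "(\<lambda>i. 1 / real (Suc (k i))) \<longlonglongrightarrow> 0"
      using LIMSEQ_subseq_LIMSEQ[OF LIMSEQ_Suc[OF lim_1_over_n] k] by (simp add: o_def)
    moreover have "norm (integral {0..t} (w (k i)) - U t) \<le> 1 / real (Suc (k i))" for i
      using w(1)[of "k i"] t by (auto simp: S_def)
    ultimately have "norm (integral {0..t} z - U t) \<le> 0"
      by (intro LIMSEQ_le) auto
    then show ?thesis by simp
  qed
  ultimately show ?thesis using Qz(2) Dl by (intro bexI[of _ z]) auto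
qed

section \<open>The Hamiltonian of a reproducing kernel\<close>

lemma lipschitz_on_balls_bounded:
  assumes "lipschitz_on_balls f"
  obtains B where "0 \<le> B" "\<And>x. norm x \<le> R \<Longrightarrow> norm (f x) \<le> B"
proof -
  obtain L where L: "L-lipschitz_on (cball 0 \<bar>R\<bar>) f"
    using assms unfolding lipschitz_on_balls_def by blast
  have "norm (f x) \<le> norm (f 0) + L * \<bar>R\<bar>" if "norm x \<le> R" for x
  proof -
    have "dist (f x) (f 0) \<le> L * dist x 0" by (rule lipschitz_onD[OF L]) (use that in auto)
    also have "\<dots> \<le> L * \<bar>R\<bar>"
      using that lipschitz_on_nonneg[OF L] by (intro mult_left_mono) auto
    finally show ?thesis
      using norm_triangle_ineq2[of "f x" "f 0"] by (simp add: dist_norm)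
  qed
  moreover have "0 \<le> norm (f 0) + L * \<bar>R\<bar>" using lipschitz_on_nonneg[OF L] by simp
  ultimately show ?thesis using that by blast
qed

lemma lipschitz_on_balls_compose_linear:
  fixes l :: "'a::real_normed_vector \<Rightarrow> 'b::real_normed_vector"
  assumes f: "lipschitz_on_balls f" and l: "bounded_linear l"
  shows "lipschitz_on_balls (\<lambda>x. f (l x))"
  unfolding lipschitz_on_balls_def
proof
  fix R
  obtain K where K: "\<And>x. norm (l x) \<le> norm x * K" "0 \<le> K"
    using bounded_linear.nonneg_bounded[OF l] by blast
  obtain L where L: "L-lipschitz_on (cball 0 (\<bar>R\<bar> * K)) f"
    using f unfolding lipschitz_on_balls_def by blast
  have "l ` cball 0 R \<subseteq> cball 0 (\<bar>R\<bar> * K)"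
  proof clarsimp
    fix x :: 'a assume "norm x \<le> R"
    then show "norm (l x) \<le> \<bar>R\<bar> * K"
      using K by (intro order_trans[OF K(1)] mult_right_mono) auto
  qed
  then have "L-lipschitz_on (l ` cball 0 R) f" by (rule lipschitz_on_subset[OF L])
  moreover have "K-lipschitz_on (cball 0 R) l"
    using K by (intro lipschitz_onI)
      (auto simp: dist_norm mult.commute simp flip: linear_diff[OF bounded_linear.linear[OF l]])
  ultimately show "\<exists>L. L-lipschitz_on (cball 0 R) (\<lambda>x. f (l x))"
    using lipschitz_on_compose2[of K "cball 0 R" l L f] by blast
qed

lemma lipschitz_on_balls_linear_compose:
  assumes l: "bounded_linear l" and f: "lipschitz_on_balls f"
  shows "lipschitz_on_balls (\<lambda>x. l (f x))"
  unfolding lipschitz_on_balls_def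
proof
  fix R
  obtain K where K: "\<And>x. norm (l x) \<le> norm x * K" "0 \<le> K"
    using bounded_linear.nonneg_bounded[OF l] by blast
  obtain L where L: "L-lipschitz_on (cball 0 R) f"
    using f unfolding lipschitz_on_balls_def by blast
  have "K-lipschitz_on (f ` cball 0 R) l"
    using K by (intro lipschitz_onI)
      (auto simp: dist_norm mult.commute simp flip: linear_diff[OF bounded_linear.linear[OF l]])
  with L show "\<exists>L. L-lipschitz_on (cball 0 R) (\<lambda>x. l (f x))"
    using lipschitz_on_compose2[of L "cball 0 R" f K l] by blast
qed

lemma lipschitz_on_balls_add:
  assumes "lipschitz_on_balls f" "lipschitz_on_balls g"
  shows "lipschitz_on_balls (\<lambda>x. f x + g x)"
  using assms lipschitz_on_add unfolding lipschitz_on_balls_def by fast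

lemma lipschitz_on_balls_const: "lipschitz_on_balls (\<lambda>x. c)"
  unfolding lipschitz_on_balls_def by (intro allI exI[of _ 0] lipschitz_onI) auto

lemma lipschitz_on_balls_linear: "bounded_linear l \<Longrightarrow> lipschitz_on_balls l"
  using lipschitz_on_balls_linear_compose[of l "\<lambda>x. x"]
  unfolding lipschitz_on_balls_def by (metis lipschitz_on_id id_def)

lemma lipschitz_on_balls_sum:
  assumes "\<And>i. i \<in> I \<Longrightarrow> lipschitz_on_balls (f i)"
  shows "lipschitz_on_balls (\<lambda>x. \<Sum>i\<in>I. f i x)"
  using assms
  by (induction I rule: infinite_finite_induct)
     (auto intro: lipschitz_on_balls_const lipschitz_on_balls_add)

lemma lipschitz_on_balls_bilinear:
  fixes f :: "'a::real_normed_vector \<Rightarrow> 'b::real_normed_vector"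
    and g :: "'a \<Rightarrow> 'c::real_normed_vector"
  assumes "bounded_bilinear mul" "lipschitz_on_balls f" "lipschitz_on_balls g"
  shows "lipschitz_on_balls (\<lambda>x. mul (f x) (g x))"
  unfolding lipschitz_on_balls_def
proof
  fix R
  interpret bounded_bilinear mul by fact
  obtain K where K: "0 \<le> K" "\<And>a b. norm (mul a b) \<le> norm a * norm b * K"
    using nonneg_bounded by blast
  obtain A where A: "0 \<le> A" "\<And>x. norm x \<le> R \<Longrightarrow> norm (f x) \<le> A"
    by (rule lipschitz_on_balls_bounded[OF assms(2)]) (rule that)
  obtain B where B: "0 \<le> B" "\<And>x. norm x \<le> R \<Longrightarrow> norm (g x) \<le> B"
    by (rule lipschitz_on_balls_bounded[OF assms(3)]) (rule that)
  obtain L1 L2 where L: "L1-lipschitz_on (cball 0 R) f" "L2-lipschitz_on (cball 0 R) g"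
    using assms unfolding lipschitz_on_balls_def by meson
  have "((A * L2 + L1 * B) * K)-lipschitz_on (cball 0 R) (\<lambda>x. mul (f x) (g x))"
  proof (rule lipschitz_onI)
    fix x y :: 'a assume x: "x \<in> cball 0 R" and y: "y \<in> cball 0 R"
    have "norm (mul (f x) (g x) - mul (f y) (g y)) = norm (mul (f x) (g x - g y) + mul (f x - f y) (g y))"
      by (simp add: diff_left diff_right)
    also have "\<dots> \<le> norm (f x) * norm (g x - g y) * K + norm (f x - f y) * norm (g y) * K"
      by (intro order_trans[OF norm_triangle_ineq] add_mono K)
    also have "\<dots> \<le> A * (L2 * dist x y) * K + (L1 * dist x y) * B * K"
      using A B K x y lipschitz_onD[OF L(1) x y] lipschitz_onD[OF L(2) x y]
        lipschitz_on_nonneg[OF L(1)] lipschitz_on_nonneg[OF L(2)]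
      by (intro add_mono mult_mono mult_nonneg_nonneg) (auto simp: dist_norm)
    finally show "dist (mul (f x) (g x)) (mul (f y) (g y)) \<le> (A * L2 + L1 * B) * K * dist x y"
      by (simp add: dist_norm algebra_simps)
  qed (use A B K lipschitz_on_nonneg[OF L(1)] lipschitz_on_nonneg[OF L(2)] in simp)
  then show "\<exists>L. L-lipschitz_on (cball 0 R) (\<lambda>x. mul (f x) (g x))" by blast
qed

text \<open>The derivative is bounded on the compact ball, whose convexity permits the mean value
  inequality.\<close>

lemma lipschitz_on_balls_C1:
  fixes f :: "'a::euclidean_space \<Rightarrow> 'b::real_normed_vector"
  assumes f: "\<And>x. (f has_derivative blinfun_apply (f' x)) (at x)" and f': "continuous_on UNIV f'"
  shows "lipschitz_on_balls f"
  unfolding lipschitz_on_balls_def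
proof
  fix R
  have "compact (f' ` cball 0 R)"
    by (intro compact_continuous_image continuous_on_subset[OF f']) auto
  then have "bounded (f' ` cball 0 R)" by (rule compact_imp_bounded)
  then obtain B where B: "B > 0" "\<And>x. x \<in> cball 0 R \<Longrightarrow> norm (f' x) \<le> B"
    unfolding bounded_pos by auto
  have "B-lipschitz_on (cball 0 R) f"
  proof (rule lipschitz_onI)
    fix x y :: 'a assume "x \<in> cball 0 R" "y \<in> cball 0 R"
    then show "dist (f x) (f y) \<le> B * dist x y"
      unfolding dist_norm using B(2)
      by (intro differentiable_bound[of "cball 0 R" f "\<lambda>x. blinfun_apply (f' x)"])
         (auto intro: has_derivative_at_withinI f simp flip: norm_blinfun.rep_eq)
  qed (use B in auto)
  then show "\<exists>L. L-lipschitz_on (cball 0 R) f" by blast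
qed

lemma bounded_bilinear_matrix_vector_mult:
  "bounded_bilinear (\<lambda>(A :: real^'m^'k) (x :: real^'m). A *v x)"
  unfolding bilinear_conv_bounded_bilinear[symmetric] bilinear_def
  by (auto intro!: linearI simp: algebra_simps scaleR_matrix_vector_assoc)

section \<open>Estimates from the continuous embedding\<close>

lemma bounded_of_vanishing:
  fixes f :: "'a::euclidean_space \<Rightarrow> 'b::real_normed_vector"
  assumes "continuous_on UNIV f" "(f \<longlongrightarrow> 0) at_infinity"
  shows "bounded (range f)"
proof -
  have "\<forall>\<^sub>F x in at_infinity. dist (f x) 0 < 1" by (rule tendstoD[OF assms(2)]) simp
  then obtain b where b: "\<And>x. norm x \<ge> b \<Longrightarrow> norm (f x) < 1"
    by (auto simp: eventually_at_infinity)
  have "bounded (f ` cball 0 b)"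
    by (intro compact_imp_bounded compact_continuous_image continuous_on_subset[OF assms(1)]) auto
  moreover have "range f \<subseteq> f ` cball 0 b \<union> ball 0 1"
    using b by (force simp: not_le)
  ultimately show ?thesis
    by (meson bounded_Un bounded_ball bounded_subset)
qed

text \<open>Elements of \<open>C1_0\<close> and their derivatives are bounded, so the suprema in
  \<open>norm_1_inf\<close> are genuine upper bounds; the second becomes a Lipschitz estimate by the
  mean value inequality.\<close>

lemma embedding_bounds:
  fixes ev :: "'v::real_normed_vector \<Rightarrow> real^'d \<Rightarrow> real^'d"
  assumes "continuously_embedded_C1_0 ev"
  obtains C where "0 \<le> C" "\<And>v z. norm (ev v z) \<le> C * norm v"
    "\<And>v z h. norm (ev v (z + h) - ev v z) \<le> C * norm v * norm h"
proof -
  obtain C0 where C0: "\<And>v. norm_1_inf (ev v) \<le> C0 * norm v"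
    and C1: "\<And>v. ev v \<in> C1_0"
    using assms unfolding continuously_embedded_C1_0_def by blast
  \<comment> \<open>The embedding constant comes without a sign, hence the absolute value.\<close>
  have le: "norm_1_inf (ev v) \<le> \<bar>C0\<bar> * norm v" for v
    by (rule order_trans[OF C0]) (simp add: mult_right_mono)
  have *: "norm (ev v z) \<le> norm_1_inf (ev v) \<and> norm (ev v (z + h) - ev v z) \<le> norm_1_inf (ev v) * norm h"
    for v z h
  proof -
    define w where "w = ev v"
    obtain w' :: "real^'d \<Rightarrow> (real^'d) \<Rightarrow>\<^sub>L (real^'d)" where w':
      "\<And>z. (w has_derivative blinfun_apply (w' z)) (at z)" "continuous_on UNIV w'"
      "(w \<longlongrightarrow> 0) at_infinity" "(w' \<longlongrightarrow> 0) at_infinity"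
      using C1[of v] unfolding C1_0_def w_def by blast
    have fd: "onorm (frechet_derivative w (at z)) = norm (w' z)" for z
      using frechet_derivative_at[OF w'(1)[of z]] by (simp add: norm_blinfun.rep_eq)
    have "continuous_on UNIV w"
      using w'(1) by (intro continuous_at_imp_continuous_on ballI has_derivative_continuous)
    then have "bounded (range w)" by (rule bounded_of_vanishing) (rule w')
    then have b1: "bdd_above (range (\<lambda>z. norm (w z)))"
      using bounded_norm_comp[of w UNIV] bounded_imp_bdd_above by (auto simp: image_image)
    have "bounded (range w')" by (rule bounded_of_vanishing) (rule w')+
    then have b2: "bdd_above (range (\<lambda>z. norm (w' z)))"
      using bounded_norm_comp[of w' UNIV] bounded_imp_bdd_above by (auto simp: image_image)
    have s1: "norm (w z) \<le> (SUP z. norm (w z))" for z by (rule cSUP_upper[OF _ b1]) simp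
    have s2: "norm (w' z) \<le> (SUP z. norm (w' z))" for z by (rule cSUP_upper[OF _ b2]) simp
    have eq: "norm_1_inf w = (SUP z. norm (w z)) + (SUP z. norm (w' z))"
      by (simp add: norm_1_inf_def fd)
    have w0: "norm (w z) \<le> norm_1_inf w" and w1: "norm (w' z) \<le> norm_1_inf w" for z
      unfolding eq using s1[of z] s2[of z] order_trans[OF norm_ge_zero s1[of z]]
        order_trans[OF norm_ge_zero s2[of z]] by linarith+
    have "norm (w (z + h) - w z) \<le> norm_1_inf w * norm (z + h - z)"
      by (rule differentiable_bound[of UNIV w "\<lambda>z. blinfun_apply (w' z)"])
         (use w' w1 in \<open>auto simp flip: norm_blinfun.rep_eq\<close>)
    then show ?thesis using w0[of z] by (simp add: w_def)
  qed
  show ?thesis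
  proof (rule that[of "\<bar>C0\<bar>"])
    show "norm (ev v z) \<le> \<bar>C0\<bar> * norm v" for v z
      using *[of v z 0] le[of v] by linarith
    show "norm (ev v (z + h) - ev v z) \<le> \<bar>C0\<bar> * norm v * norm h" for v z h
      using *[of v z h] mult_right_mono[OF le[of v], of "norm h"] by auto
  qed simp
qed

section \<open>Gradients of the Hamiltonian\<close>

lemma grad_eq:
  assumes "(f has_derivative (\<lambda>h. D \<bullet> h)) (at x)"
  shows "grad f x = D"
  unfolding grad_def
proof (rule the_equality)
  show "GDERIV f x :> D" using assms by (simp add: gderiv_def inner_commute)
  fix D' assume "GDERIV f x :> D'"
  then have "(\<lambda>h. h \<bullet> D') = (\<lambda>h. D \<bullet> h)"
    unfolding gderiv_def by (rule has_derivative_unique[OF _ assms])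
  then have "\<forall>h. h \<bullet> D' = h \<bullet> D" by (metis inner_commute)
  then show "D' = D" by (simp add: vector_eq_ldot)
qed

text \<open>The derivative is taken jointly in positions and momenta, as the chain rule along
  trajectories requires. The kernel being \<open>C^2\<close>, its first derivative is Lipschitz on
  balls, and this passes to \<open>gx\<close> and \<open>gp\<close> through sums and bilinear
  products.\<close>

lemma H0_has_derivative:
  fixes K :: "real^'d \<Rightarrow> real^'d \<Rightarrow> real^'d^'d"
  assumes "class_C2 (\<lambda>(z, z'). K z z')"
  obtains gx gp :: "(real^'d^'n) \<times> (real^'d^'n) \<Rightarrow> real^'d^'n"
  where "\<And>q. ((\<lambda>q. H0 K (fst q) (snd q)) has_derivative (\<lambda>h. gx q \<bullet> fst h + gp q \<bullet> snd h)) (at q)"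
    "lipschitz_on_balls gx" "lipschitz_on_balls gp"
proof -
  define F where "F = (\<lambda>(z, z'). K z z')"
  obtain F' :: "(real^'d) \<times> (real^'d) \<Rightarrow> ((real^'d) \<times> (real^'d)) \<Rightarrow>\<^sub>L (real^'d^'d)" and F'' where F:
    "\<And>x. (F has_derivative blinfun_apply (F' x)) (at x)"
    "\<And>x. (F' has_derivative blinfun_apply (F'' x)) (at x)" "continuous_on UNIV F''"
    using assms unfolding class_C2_def F_def by blast
  have F'_lip: "lipschitz_on_balls F'" by (rule lipschitz_on_balls_C1[OF F(2,3)])
  have "continuous_on UNIV F'"
    using F(2) by (intro continuous_at_imp_continuous_on ballI has_derivative_continuous)
  then have F_lip: "lipschitz_on_balls F" by (rule lipschitz_on_balls_C1[OF F(1)])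
  define l :: "'n \<Rightarrow> 'n \<Rightarrow> (real^'d^'n) \<times> (real^'d^'n) \<Rightarrow> (real^'d) \<times> (real^'d)"
    where "l i j q = (fst q $ i, fst q $ j)" for i j q
  define m :: "'n \<Rightarrow> (real^'d^'n) \<times> (real^'d^'n) \<Rightarrow> real^'d"
    where "m i q = snd q $ i" for i q
  have l: "bounded_linear (l i j)" for i j
    unfolding l_def
    by (intro bounded_linear_Pair bounded_linear_compose[OF bounded_linear_vec_nth] bounded_linear_fst)
  have m: "bounded_linear (m i)" for i
    unfolding m_def by (intro bounded_linear_compose[OF bounded_linear_vec_nth] bounded_linear_snd)
  note mv = bounded_bilinear_matrix_vector_mult
  define D where "D q h = (1/2) * (\<Sum>i\<in>UNIV. \<Sum>j\<in>UNIV.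
      m i q \<bullet> (F (l i j q) *v m j h + F' (l i j q) (l i j h) *v m j q) + m i h \<bullet> (F (l i j q) *v m j q))"
    for q h
  have H0_eq: "H0 K (fst q) (snd q) = (1/2) * (\<Sum>i\<in>UNIV. \<Sum>j\<in>UNIV. m i q \<bullet> (F (l i j q) *v m j q))" for q
    by (simp add: H0_def F_def l_def m_def)
  have D: "((\<lambda>q. H0 K (fst q) (snd q)) has_derivative D q) (at q)" for q
    unfolding H0_eq D_def
    by (intro has_derivative_mult_right has_derivative_sum
        bounded_bilinear.FDERIV[OF bounded_bilinear_inner] bounded_bilinear.FDERIV[OF mv]
        bounded_linear_imp_has_derivative m has_derivative_compose[OF bounded_linear_imp_has_derivative[OF l] F(1)])
  have D_lip: "lipschitz_on_balls (\<lambda>q. D q h)" for h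
    unfolding D_def
    by (intro lipschitz_on_balls_linear_compose[OF bounded_linear_mult_right] lipschitz_on_balls_sum
        lipschitz_on_balls_add lipschitz_on_balls_bilinear[OF bounded_bilinear_inner]
        lipschitz_on_balls_bilinear[OF mv] lipschitz_on_balls_linear[OF m] lipschitz_on_balls_const
        lipschitz_on_balls_compose_linear[OF F_lip l]
        lipschitz_on_balls_linear_compose[OF blinfun.bounded_linear_left]
        lipschitz_on_balls_compose_linear[OF F'_lip l])
  \<comment> \<open>The gradients are assembled from values of \<open>D q\<close> at basis vectors,
    so the Lipschitz property of \<open>D q h\<close> is needed only for fixed
    \<open>h\<close>.\<close>
  define gx where "gx q = (\<Sum>b\<in>Basis. D q (b, 0) *\<^sub>R b)" for q
  define gp where "gp q = (\<Sum>b\<in>Basis. D q (0, b) *\<^sub>R b)" for q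
  have lin: "linear (D q)" for q by (rule has_derivative_linear[OF D])
  have "D q h = gx q \<bullet> fst h + gp q \<bullet> snd h" for q h
  proof -
    have l1: "linear (\<lambda>a. D q (a, 0))"
      using linear_compose[OF _ lin[of q], of "\<lambda>a. (a, 0)"] by (auto simp: linear_iff o_def)
    have l2: "linear (\<lambda>a. D q (0, a))"
      using linear_compose[OF _ lin[of q], of "\<lambda>a. (0, a)"] by (auto simp: linear_iff o_def)
    have "D q (a, 0) = gx q \<bullet> a" for a
    proof -
      have "D q (a, 0) = (\<Sum>b\<in>Basis. (a \<bullet> b) * D q (b, 0))"
        by (subst euclidean_representation[of a, symmetric])
           (simp add: linear_sum[OF l1] linear_scale[OF l1])
      then show ?thesis by (simp add: gx_def inner_sum_left inner_commute[of a] mult.commute)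
    qed
    moreover have "D q (0, a) = gp q \<bullet> a" for a
    proof -
      have "D q (0, a) = (\<Sum>b\<in>Basis. (a \<bullet> b) * D q (0, b))"
        by (subst euclidean_representation[of a, symmetric])
           (simp add: linear_sum[OF l2] linear_scale[OF l2])
      then show ?thesis by (simp add: gp_def inner_sum_left inner_commute[of a] mult.commute)
    qed
    moreover have "D q h = D q (fst h, 0) + D q (0, snd h)"
      by (simp flip: linear_add[OF lin])
    ultimately show ?thesis by simp
  qed
  then have "D q = (\<lambda>h. gx q \<bullet> fst h + gp q \<bullet> snd h)" for q by blast
  then show ?thesis
  proof (intro that)
    show "lipschitz_on_balls gx" "lipschitz_on_balls gp"
      unfolding gx_def gp_def
      by (intro lipschitz_on_balls_sum lipschitz_on_balls_bilinear[OF bounded_bilinear_scaleR]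
          D_lip lipschitz_on_balls_const)+
  qed (use D in simp)
qed

text \<open>\<open>k z \<alpha>\<close> is the Riesz representative of evaluation at
  \<open>z\<close> in direction \<open>\<alpha>\<close>. By duality the embedding estimates for
  fields become estimates for \<open>k\<close>, and \<open>H0\<close> is half the squared norm of
  the sum of the \<open>k (x $ i) (p $ i)\<close>.\<close>

lemma kernel_hamiltonian_H0:
  fixes ev :: "'v::real_inner \<Rightarrow> real^'d \<Rightarrow> real^'d"
    and K :: "real^'d \<Rightarrow> real^'d \<Rightarrow> real^'d^'d"
  assumes emb: "continuously_embedded_C1_0 ev" and rep: "reproducing_kernel ev K"
    and C2: "class_C2 (\<lambda>(z, z'). K z z')"
  obtains gx gp :: "(real^'d^'n) \<times> (real^'d^'n) \<Rightarrow> real^'d^'n"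
    and v :: "real^'d^'n \<Rightarrow> real^'d^'n \<Rightarrow> 'v" and C :: real
  where "kernel_hamiltonian (\<lambda>q. H0 K (fst q) (snd q)) gx gp v C"
    "\<And>x p. dx_H0 K x p = gx (x, p)" "\<And>x p. dp_H0 K x p = gp (x, p)"
proof -
  obtain C where C: "0 \<le> C" "\<And>v z. norm (ev v z) \<le> C * norm v"
    "\<And>v z h. norm (ev v (z + h) - ev v z) \<le> C * norm v * norm h"
    by (rule embedding_bounds[OF emb]) (rule that)
  obtain gx gp :: "(real^'d^'n) \<times> (real^'d^'n) \<Rightarrow> real^'d^'n" where
    deriv: "\<And>q. ((\<lambda>q. H0 K (fst q) (snd q)) has_derivative (\<lambda>h. gx q \<bullet> fst h + gp q \<bullet> snd h)) (at q)"
    and lip: "lipschitz_on_balls gx" "lipschitz_on_balls gp"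
    by (rule H0_has_derivative[OF C2]) (rule that)
  obtain k where k: "\<And>z \<alpha>. ev (k z \<alpha>) = (\<lambda>z'. K z' z *v \<alpha>)" "\<And>z \<alpha> v. v \<bullet> k z \<alpha> = ev v z \<bullet> \<alpha>"
    using rep unfolding reproducing_kernel_def by metis
  \<comment> \<open>\<open>k\<close> is only chosen pointwise, but representatives are unique and
    hence depend linearly on the direction.\<close>
  have k_linear: "linear (k z)" for z
  proof (rule linearI)
    fix a b r
    have "\<forall>v. v \<bullet> k z (a + b) = v \<bullet> (k z a + k z b)" by (simp add: k(2) inner_add_right)
    then show "k z (a + b) = k z a + k z b" by (simp only: vector_eq_ldot)
    have "\<forall>v. v \<bullet> k z (r *\<^sub>R a) = v \<bullet> (r *\<^sub>R k z a)" by (simp add: k(2))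
    then show "k z (r *\<^sub>R a) = r *\<^sub>R k z a" by (simp only: vector_eq_ldot)
  qed
  have k_le: "norm (k z \<alpha>) \<le> C * norm \<alpha>" for z \<alpha>
  proof (rule le_of_square_le)
    have "norm (k z \<alpha>) * norm (k z \<alpha>) = ev (k z \<alpha>) z \<bullet> \<alpha>"
      by (simp add: k(2)[symmetric] norm_eq_sqrt_inner flip: power2_eq_square)
    also have "\<dots> \<le> norm (ev (k z \<alpha>) z) * norm \<alpha>" by (rule norm_cauchy_schwarz)
    also have "\<dots> \<le> C * norm (k z \<alpha>) * norm \<alpha>" by (intro mult_right_mono C) auto
    finally show "norm (k z \<alpha>) * norm (k z \<alpha>) \<le> C * norm \<alpha> * norm (k z \<alpha>)" by (simp add: ac_simps)
  qed (use C in auto)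
  \<comment> \<open>Testing the difference \<open>e\<close> against itself reduces dependence on the
    base point to the Lipschitz estimate for the field of \<open>e\<close>.\<close>
  have k_diff_le: "norm (k (z + h) \<alpha> - k z \<alpha>) \<le> C * norm h * norm \<alpha>" for z h \<alpha>
  proof (rule le_of_square_le)
    define e where "e = k (z + h) \<alpha> - k z \<alpha>"
    have "norm e * norm e = e \<bullet> e" by (simp add: norm_eq_sqrt_inner flip: power2_eq_square)
    also have "\<dots> = (ev e (z + h) - ev e z) \<bullet> \<alpha>"
      by (subst (2) e_def) (simp add: inner_diff_right inner_diff_left k(2))
    also have "\<dots> \<le> norm (ev e (z + h) - ev e z) * norm \<alpha>" by (rule norm_cauchy_schwarz)
    also have "\<dots> \<le> C * norm e * norm h * norm \<alpha>" by (intro mult_right_mono C) auto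
    finally show "norm (k (z + h) \<alpha> - k z \<alpha>) * norm (k (z + h) \<alpha> - k z \<alpha>)
        \<le> C * norm h * norm \<alpha> * norm (k (z + h) \<alpha> - k z \<alpha>)" by (simp add: e_def ac_simps)
  qed (use C in auto)
  define v :: "real^'d^'n \<Rightarrow> real^'d^'n \<Rightarrow> 'v" where "v x p = (\<Sum>i\<in>UNIV. k (x $ i) (p $ i))" for x p
  \<comment> \<open>One contribution for each of the \<open>CARD('n)\<close> summands, with
    components estimated by the norms of whole tuples.\<close>
  define C' where "C' = real CARD('n) * C"
  have "kernel_hamiltonian (\<lambda>q. H0 K (fst q) (snd q)) gx gp v C'"
  proof (rule kernel_hamiltonian.intro)
    fix x p h :: "real^'d^'n"
    have "(norm (v x p))\<^sup>2 = (\<Sum>i\<in>UNIV. \<Sum>j\<in>UNIV. k (x $ j) (p $ j) \<bullet> k (x $ i) (p $ i))"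
      by (simp add: v_def power2_norm_eq_inner inner_sum_left inner_sum_right)
    also have "\<dots> = (\<Sum>i\<in>UNIV. \<Sum>j\<in>UNIV. p $ i \<bullet> (K (x $ i) (x $ j) *v p $ j))"
      unfolding k by (intro sum.cong refl inner_commute)
    finally show "H0 K (fst (x, p)) (snd (x, p)) = (norm (v x p))\<^sup>2 / 2"
      by (simp add: H0_def)
    have "linear (\<lambda>p. k (x $ i) (p $ i))" for i
      using linear_compose[OF bounded_linear.linear[OF bounded_linear_vec_nth] k_linear]
      by (simp add: o_def)
    then show "linear (v x)" unfolding v_def[abs_def] by (intro linear_compose_sum ballI)
    have "norm (v x p) \<le> (\<Sum>i\<in>(UNIV :: 'n set). C * norm p)"
      unfolding v_def
      by (intro sum_norm_le order_trans[OF k_le] mult_left_mono Finite_Cartesian_Product.norm_nth_le C)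
    then show "norm (v x p) \<le> C' * norm p" by (simp add: C'_def)
    have "norm (v (x + h) p - v x p) = norm (\<Sum>i\<in>UNIV. k (x $ i + h $ i) (p $ i) - k (x $ i) (p $ i))"
      by (simp add: v_def sum_subtractf)
    also have "\<dots> \<le> (\<Sum>i\<in>(UNIV :: 'n set). C * norm h * norm p)"
      by (intro sum_norm_le order_trans[OF k_diff_le] mult_mono mult_left_mono
          Finite_Cartesian_Product.norm_nth_le C mult_nonneg_nonneg) auto
    finally show "norm (v (x + h) p - v x p) \<le> C' * norm h * norm p" by (simp add: C'_def)
  qed (use C deriv lip in \<open>auto simp: C'_def\<close>)
  moreover have "dx_H0 K x p = gx (x, p)" for x p
    unfolding dx_H0_def
    using has_derivative_compose[OF has_derivative_Pair[OF has_derivative_ident has_derivative_const] deriv]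
    by (intro grad_eq) simp
  moreover have "dp_H0 K x p = gp (x, p)" for x p
    unfolding dp_H0_def
    using has_derivative_compose[OF has_derivative_Pair[OF has_derivative_const has_derivative_ident] deriv]
    by (intro grad_eq) simp
  ultimately show ?thesis by (rule that)
qed

section \<open>Controlled trajectories\<close>

text \<open>Young's inequality with a free parameter \<open>\<kappa>\<close> takes the place of the
  Cauchy-Schwarz bound: \<open>\<kappa> = 1\<close> bounds the total mass of the control, small
  \<open>\<kappa>\<close> yields equicontinuity.\<close>

lemma L2_primitive:
  fixes u :: "real \<Rightarrow> 'a::euclidean_space"
  assumes T: "0 \<le> T" and u: "u \<in> L2 T"
  shows "continuous_on {0..T} (\<lambda>t. integral {0..t} u)"
    and "continuous_on {0..T} (\<lambda>t. integral {0..t} (\<lambda>s. norm (u s)))"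
    and "\<forall>s\<in>{0..T}. \<forall>t\<in>{s..T}. norm (integral {0..t} u - integral {0..s} u)
      \<le> integral {0..t} (\<lambda>s. norm (u s)) - integral {0..s} (\<lambda>s. norm (u s))"
    and "\<And>\<kappa> s t. \<kappa> > 0 \<Longrightarrow> s \<in> {0..T} \<Longrightarrow> t \<in> {s..T} \<Longrightarrow>
      integral {0..t} (\<lambda>s. norm (u s)) - integral {0..s} (\<lambda>s. norm (u s))
      \<le> (t - s) / (2 * \<kappa>) + \<kappa> / 2 * (LINT s|lebesgue_on {0..T}. (norm (u s))\<^sup>2)"
proof -
  let ?M = "lebesgue_on {0..T}" and ?N = "\<lambda>s. norm (u s)" and ?S = "\<lambda>s. (norm (u s))\<^sup>2"
  have L: "integrable ?M u" "integrable ?M ?N" "integrable ?M ?S"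
    using L2_integrable[OF u] L2_norm_square[OF u] by auto
  have i: "u integrable_on {0..T}" "?N integrable_on {0..T}" "?S integrable_on {0..T}"
    using L by (auto intro: integrable_on_lebesgue_on)
  show "continuous_on {0..T} (\<lambda>t. integral {0..t} u)"
    "continuous_on {0..T} (\<lambda>t. integral {0..t} ?N)"
    using i by (auto intro: indefinite_integral_continuous_1)
  have sub: "f integrable_on {s..t}" if "f integrable_on {0..T}" "s \<in> {0..T}" "t \<in> {s..T}"
    for f :: "real \<Rightarrow> 'z::banach" and s t
    by (rule integrable_subinterval_real[OF that(1)]) (use that in auto)
  have split: "integral {0..t} f - integral {0..s} f = integral {s..t} f"
    if "f integrable_on {0..T}" "s \<in> {0..T}" "t \<in> {s..T}" for f :: "real \<Rightarrow> 'z::banach" and s t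
    using Henstock_Kurzweil_Integration.integral_combine[of 0 s t f] sub[OF that(1), of 0 t] that
    by (auto simp: algebra_simps)
  show "\<forall>s\<in>{0..T}. \<forall>t\<in>{s..T}. norm (integral {0..t} u - integral {0..s} u)
      \<le> integral {0..t} ?N - integral {0..s} ?N"
  proof (intro ballI)
    fix s t assume st: "s \<in> {0..T}" "t \<in> {s..T}"
    show "norm (integral {0..t} u - integral {0..s} u) \<le> integral {0..t} ?N - integral {0..s} ?N"
      unfolding split[OF i(1) st] split[OF i(2) st]
      by (rule Henstock_Kurzweil_Integration.integral_norm_bound_integral) (use sub[OF _ st] i in auto)
  qed
  fix \<kappa> s t :: real assume \<kappa>: "\<kappa> > 0" and st: "s \<in> {0..T}" "t \<in> {s..T}"
  have amgm: "y \<le> 1 / (2 * \<kappa>) + \<kappa> / 2 * y\<^sup>2" for y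
  proof -
    have "0 \<le> (1 - \<kappa> * y)\<^sup>2 / (2 * \<kappa>)" using \<kappa> by simp
    also have "\<dots> = 1 / (2 * \<kappa>) + \<kappa> / 2 * y\<^sup>2 - y"
      using \<kappa> by (simp add: power2_eq_square field_simps)
    finally show ?thesis by simp
  qed
  have iS: "(\<lambda>x. \<kappa> / 2 * ?S x) integrable_on {s..t}"
    using integrable_on_mult_right[OF sub[OF i(3) st]] by simp
  have "integral {s..t} ?N \<le> integral {s..t} (\<lambda>x. 1 / (2 * \<kappa>) + \<kappa> / 2 * ?S x)"
    by (rule integral_le[OF sub[OF i(2) st] integrable_add[OF integrable_const_ivl iS]]) (rule amgm)
  also have "\<dots> = (t - s) / (2 * \<kappa>) + \<kappa> / 2 * integral {s..t} ?S"
    using st by (subst integral_add[OF integrable_const_ivl iS]) auto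
  also have "\<dots> \<le> (t - s) / (2 * \<kappa>) + \<kappa> / 2 * integral {0..T} ?S"
    using st \<kappa> by (intro add_left_mono mult_left_mono integral_subset_le sub[OF i(3)] i(3)) auto
  also have "integral {0..T} ?S = integral\<^sup>L ?M ?S"
    by (rule lebesgue_integral_eq_integral[OF L(3), symmetric]) simp
  finally show "integral {0..t} ?N - integral {0..s} ?N
      \<le> (t - s) / (2 * \<kappa>) + \<kappa> / 2 * integral\<^sup>L ?M ?S"
    by (simp only: split[OF i(2) st])
qed

context kernel_hamiltonian
begin

abbreviation controlled :: "real \<Rightarrow> 'b \<times> 'b \<Rightarrow> (real \<Rightarrow> 'b) \<Rightarrow> (real \<Rightarrow> 'b \<times> 'b) \<Rightarrow> bool" where
  "controlled \<tau> q0 u \<equiv> integral_solution field (\<lambda>t. q0 + (0, integral {0..t} u)) \<tau>"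

text \<open>The general bound with \<open>a = (T + B) / 2\<close>, the estimate of the total mass by
  Young's inequality with parameter 1.\<close>

lemma controlled_bound:
  assumes T: "0 \<le> T" and u: "u \<in> L2 T" and B: "(LINT s|lebesgue_on {0..T}. (norm (u s))\<^sup>2) \<le> B"
    and r: "norm q0 \<le> r" and \<tau>: "\<tau> \<in> {0..T}" and q: "controlled \<tau> q0 u q"
  shows "norm (q \<tau>) \<le> r + T * C * (C * (r + (T + B) / 2)) +
    (r + (T + B) / 2) * exp (C * (C * (r + (T + B) / 2)) * T)"
proof (rule solution_bound[OF _ _ _ _ _ _ _ q r])
  let ?A = "\<lambda>t. integral {0..t} (\<lambda>s. norm (u s))"
  note P = L2_primitive[OF T u]
  have \<tau>T: "{0..\<tau>} \<subseteq> {0..T}" using \<tau> by auto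
  show "continuous_on {0..\<tau>} (\<lambda>t. integral {0..t} u)" "continuous_on {0..\<tau>} ?A"
    using P(1,2) \<tau>T by (auto intro: continuous_on_subset)
  show "\<forall>s\<in>{0..\<tau>}. \<forall>t\<in>{s..\<tau>}. norm (integral {0..t} u - integral {0..s} u) \<le> ?A t - ?A s"
    using P(3) \<tau> by auto
  show "?A \<tau> \<le> (T + B) / 2"
    using P(4)[of 1 0 \<tau>] \<tau> B by auto
qed (use \<tau> in auto)

lemma controlled_exists:
  assumes T: "0 \<le> T" and u: "u \<in> L2 T"
  shows "\<exists>q. controlled T q0 u q \<and> (\<forall>q'. controlled T q0 u q' \<longrightarrow> (\<forall>t\<in>{0..T}. q' t = q t))"
proof (rule integral_solution_apriori[OF T _ lipschitz_field])
  show "continuous_on {0..T} (\<lambda>t. q0 + (0, integral {0..t} u))"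
    by (intro continuous_intros L2_primitive(1)[OF T u])
qed (rule controlled_bound[OF T u order_refl order_refl])

lemma controlled_initial: "0 \<le> T \<Longrightarrow> controlled T q0 u q \<Longrightarrow> q 0 = q0"
  by (auto simp: integral_solution_def zero_prod_def[symmetric])

text \<open>Besides the limit, the common radius \<open>R\<close> is returned: it selects the ball
  on which the field is later Lipschitz and \<open>\<K>\<close> uniformly continuous.\<close>

lemma controlled_compactness:
  fixes u :: "nat \<Rightarrow> real \<Rightarrow> 'b"
  assumes T: "0 \<le> T" and u: "\<And>m. u m \<in> L2 T"
    and B: "\<And>m. (LINT s|lebesgue_on {0..T}. (norm (u m s))\<^sup>2) \<le> B"
    and r: "\<And>m. norm (q0 m) \<le> r" and q: "\<And>m. controlled T (q0 m) (u m) (q m)"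
  obtains k z R where "strict_mono k" "continuous_on {0..T} z"
    "\<And>m t. t \<in> {0..T} \<Longrightarrow> norm (q m t) \<le> R"
    "uniform_limit {0..T} (\<lambda>m. q (k m)) z sequentially"
proof -
  define R where "R = r + T * C * (C * (r + (T + B) / 2)) +
    (r + (T + B) / 2) * exp (C * (C * (r + (T + B) / 2)) * T)"
  have R: "norm (q m t) \<le> R" if "t \<in> {0..T}" for m t
    unfolding R_def
    by (rule controlled_bound[OF T u B r that integral_solution_restrict[OF q]]) (use that in auto)
  obtain F where F: "0 \<le> F" "\<And>x. norm x \<le> R \<Longrightarrow> norm (field x) \<le> F"
    by (rule lipschitz_on_balls_bounded[OF lipschitz_field]) (rule that)
  have B0: "0 \<le> B" by (rule order_trans[OF _ B[of 0]]) simp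
  have incr: "norm (q m t - q m s) \<le> F * (t - s) + (t - s) / (2 * \<kappa>) + \<kappa> / 2 * B"
    if \<kappa>: "\<kappa> > 0" and st: "s \<in> {0..T}" "t \<in> {s..T}" for \<kappa> m s t
  proof -
    have qc: "continuous_on {0..T} (q m)" using q by (simp add: integral_solution_def)
    have int: "(\<lambda>x. field (q m x)) integrable_on {a..b}" if "{a..b} \<subseteq> {0..T}" for a b :: real
      by (intro integrable_continuous_real continuous_on_compose2[OF continuous_field
          continuous_on_subset[OF qc that]]) auto
    have "integral {0..t} (\<lambda>x. field (q m x)) =
        integral {0..s} (\<lambda>x. field (q m x)) + integral {s..t} (\<lambda>x. field (q m x))"
      by (rule Henstock_Kurzweil_Integration.integral_combine[symmetric]) (use st in \<open>auto intro!: int\<close>)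
    moreover have "q m t = q0 m + (0, integral {0..t} (u m)) + integral {0..t} (\<lambda>x. field (q m x))"
      "q m s = q0 m + (0, integral {0..s} (u m)) + integral {0..s} (\<lambda>x. field (q m x))"
      using q st unfolding integral_solution_def by auto
    ultimately have "q m t - q m s = integral {s..t} (\<lambda>x. field (q m x)) +
        (0, integral {0..t} (u m) - integral {0..s} (u m))"
      by (simp add: prod_eq_iff)
    then have "norm (q m t - q m s) \<le> norm (integral {s..t} (\<lambda>x. field (q m x))) +
        norm (integral {0..t} (u m) - integral {0..s} (u m))"
      using norm_triangle_ineq[of "integral {s..t} (\<lambda>x. field (q m x))"
          "(0, integral {0..t} (u m) - integral {0..s} (u m))"] by (simp add: norm_Pair)
    moreover have "norm (integral {s..t} (\<lambda>x. field (q m x))) \<le> integral {s..t} (\<lambda>x. F)"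
      by (rule Henstock_Kurzweil_Integration.integral_norm_bound_integral)
         (use st in \<open>auto intro!: int F(2) R\<close>)
    moreover have "integral {s..t} (\<lambda>x. F) = F * (t - s)" using st by simp
    moreover note L2_primitive(3)[OF T u[of m], rule_format, OF st] L2_primitive(4)[OF T u[of m] \<kappa> st]
    moreover have "\<kappa> / 2 * (LINT s|lebesgue_on {0..T}. (norm (u m s))\<^sup>2) \<le> \<kappa> / 2 * B"
      using \<kappa> B[of m] by (intro mult_left_mono) auto
    ultimately show ?thesis by linarith
  qed
  obtain z k where z: "continuous_on {0..T} z" and k: "strict_mono (k :: nat \<Rightarrow> nat)"
    and lim: "\<And>e. 0 < e \<Longrightarrow> \<exists>N. \<forall>n t. n \<ge> N \<and> t \<in> {0..T} \<longrightarrow> norm (q (k n) t - z t) < e"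
  proof (rule Arzela_Ascoli[of "{0..T}" q R])
    fix s e :: real assume s: "s \<in> {0..T}" and e: "0 < e"
    \<comment> \<open>This makes the share \<open>\<kappa> / 2 * B\<close> of the control less than
      \<open>e / 2\<close>, the added 1 covering \<open>B = 0\<close>; the other terms are linear in
      the time difference, with slope \<open>G\<close>.\<close>
    define \<kappa> where "\<kappa> = e / (B + 1)"
    have \<kappa>: "\<kappa> > 0" "\<kappa> / 2 * B < e / 2" using e B0 by (auto simp: \<kappa>_def field_simps)
    define G where "G = F + 1 / (2 * \<kappa>)"
    have G: "G > 0" using F \<kappa> by (simp add: G_def add_nonneg_pos)
    show "\<exists>d>0. \<forall>n y. y \<in> {0..T} \<and> norm (s - y) < d \<longrightarrow> norm (q n s - q n y) < e"
    proof (intro exI[of _ "e / (2 * G)"] conjI allI impI)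
      show "0 < e / (2 * G)" using e G by simp
      fix n y assume y: "y \<in> {0..T} \<and> norm (s - y) < e / (2 * G)"
      define a b where "a = min s y" and "b = max s y"
      have ab: "a \<in> {0..T}" "b \<in> {a..T}" "b - a = norm (s - y)" using s y by (auto simp: a_def b_def)
      have "norm (q n s - q n y) = norm (q n b - q n a)"
        by (auto simp: a_def b_def min_def max_def norm_minus_commute)
      also have "\<dots> \<le> G * (b - a) + \<kappa> / 2 * B"
        using incr[OF \<kappa>(1) ab(1,2), of n] by (simp add: G_def algebra_simps)
      also have "G * (b - a) < e / 2" using y G unfolding ab(3) by (simp add: field_simps)
      finally show "norm (q n s - q n y) < e" using \<kappa>(2) by simp
    qed
  qed (use R in auto)
  have "uniform_limit {0..T} (\<lambda>m. q (k m)) z sequentially"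
  proof (rule uniform_limitI)
    fix e :: real assume "e > 0"
    from lim[OF this] show "\<forall>\<^sub>F n in sequentially. \<forall>x\<in>{0..T}. dist (q (k n) x) (z x) < e"
      unfolding eventually_sequentially dist_norm by blast
  qed
  then show ?thesis using that k z R by blast
qed

text \<open>Solving the integral equation for the primitive of the control shows that the primitives
  converge uniformly along with the trajectories. Any control with primitive \<open>U\<close> then
  satisfies the equation for \<open>z\<close>, so no limit of the controls is required.\<close>

lemma controlled_limit:
  assumes T: "0 \<le> T" and q: "\<And>m. controlled T (q0 m) (u m) (q m)" and z: "continuous_on {0..T} z"
    and R: "\<And>m t. t \<in> {0..T} \<Longrightarrow> norm (q m t) \<le> R"
    and lim: "uniform_limit {0..T} q z sequentially"
  obtains U where
    "\<And>e. e > 0 \<Longrightarrow> \<forall>\<^sub>F m in sequentially. \<forall>t\<in>{0..T}. norm (integral {0..t} (u m) - U t) \<le> e"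
    "\<forall>w. (\<forall>t\<in>{0..T}. integral {0..t} w = U t) \<longrightarrow> controlled T (z 0) w z"
proof -
  have zR: "norm (z t) \<le> R" if t: "t \<in> {0..T}" for t
    by (rule tendsto_upperbound[OF tendsto_norm[OF tendsto_uniform_limitI[OF lim t]]])
       (use R[OF t] in auto)
  obtain L where L: "L-lipschitz_on (cball 0 R) field"
    using lipschitz_field unfolding lipschitz_on_balls_def by blast
  have L0: "0 \<le> L" using lipschitz_on_nonneg[OF L] .
  have int: "(\<lambda>s. field (y s)) integrable_on {0..t}" if "continuous_on {0..T} y" "t \<in> {0..T}" for y t
    by (intro integrable_continuous_real continuous_on_compose2[OF continuous_field
        continuous_on_subset[OF that(1)]]) (use that(2) in auto)
  have qc: "continuous_on {0..T} (q m)" for m using q by (simp add: integral_solution_def)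
  define Z where "Z t = z t - z 0 - integral {0..t} (\<lambda>s. field (z s))" for t
  have Z: "\<forall>\<^sub>F m in sequentially. \<forall>t\<in>{0..T}. norm ((0, integral {0..t} (u m)) - Z t) \<le> e"
    if e: "e > 0" for e
  proof -
    \<comment> \<open>Three errors add up to \<open>e\<close>: that of the curve at
      \<open>t\<close>, that at time 0, and the integrated difference of the fields, at most
      \<open>T * L * \<delta>\<close>.\<close>
    define \<delta> where "\<delta> = e / (2 + T * L)"
    have TL: "2 + T * L > 0" using T L0 by (simp add: add_pos_nonneg)
    have "\<delta> + \<delta> + T * L * \<delta> = \<delta> * (2 + T * L)" by (simp add: algebra_simps)
    then have \<delta>: "\<delta> > 0" "\<delta> + \<delta> + T * L * \<delta> = e"
      using e TL by (auto simp: \<delta>_def)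
    from uniform_limitD[OF lim \<delta>(1)] show ?thesis
    proof eventually_elim
      case (elim m)
      show ?case
      proof
        fix t assume t: "t \<in> {0..T}"
        have "norm (integral {0..t} (\<lambda>s. field (q m s) - field (z s))) \<le> integral {0..t} (\<lambda>s. L * \<delta>)"
        proof (rule Henstock_Kurzweil_Integration.integral_norm_bound_integral)
          fix s assume "s \<in> {0..t}"
          then have s: "s \<in> {0..T}" using t by auto
          have "norm (field (q m s) - field (z s)) \<le> L * dist (q m s) (z s)"
            using lipschitz_onD[OF L] R[OF s] zR[OF s] by (simp add: dist_norm)
          also have "\<dots> \<le> L * \<delta>" using elim s L0 by (intro mult_left_mono) (auto simp: less_imp_le)
          finally show "norm (field (q m s) - field (z s)) \<le> L * \<delta>" .
        qed (auto intro!: integrable_diff int qc z t)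
        also have "\<dots> = t * (L * \<delta>)" using t by simp
        also have "\<dots> \<le> T * (L * \<delta>)" using t L0 \<delta> by (intro mult_right_mono) auto
        finally have I: "norm (integral {0..t} (\<lambda>s. field (q m s)) - integral {0..t} (\<lambda>s. field (z s)))
            \<le> T * L * \<delta>"
          by (simp add: Henstock_Kurzweil_Integration.integral_diff[OF int[OF qc t] int[OF z t]] mult.assoc)
        have n: "norm (q m s - z s) \<le> \<delta>" if "s \<in> {0..T}" for s
          using elim that by (auto simp: dist_norm less_imp_le)
        have "(0, integral {0..t} (u m)) = q m t - q m 0 - integral {0..t} (\<lambda>s. field (q m s))"
          using q[of m] t controlled_initial[OF T q[of m]] unfolding integral_solution_def by auto
        then have "(0, integral {0..t} (u m)) - Z t = (q m t - z t) - (q m 0 - z 0) -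
            (integral {0..t} (\<lambda>s. field (q m s)) - integral {0..t} (\<lambda>s. field (z s)))"
          by (simp add: Z_def)
        then show "norm ((0, integral {0..t} (u m)) - Z t) \<le> e"
          using I n[OF t] n[of 0] T \<delta>(2)
            norm_triangle_ineq4[of "(q m t - z t) - (q m 0 - z 0)"
              "integral {0..t} (\<lambda>s. field (q m s)) - integral {0..t} (\<lambda>s. field (z s))"]
            norm_triangle_ineq4[of "q m t - z t" "q m 0 - z 0"] by simp
      qed
    qed
  qed
  \<comment> \<open>The control does not act on the positions, so the approximants of
    \<open>Z\<close> have first component 0.\<close>
  have fst0: "fst (Z t) = 0" if t: "t \<in> {0..T}" for t
  proof -
    have "norm (fst (Z t)) \<le> 0 + e" if e: "e > 0" for e
    proof -
      obtain m where "norm ((0, integral {0..t} (u m)) - Z t) \<le> e"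
        using eventually_happens'[OF trivial_limit_sequentially Z[OF e]] t by blast
      then show ?thesis
        using norm_fst_le[of "fst ((0, integral {0..t} (u m)) - Z t)" "snd ((0, integral {0..t} (u m)) - Z t)"]
        by (cases "Z t") simp
    qed
    then have "norm (fst (Z t)) \<le> 0" by (rule field_le_epsilon)
    then show ?thesis by simp
  qed
  show ?thesis
  proof (rule that[of "\<lambda>t. snd (Z t)"])
    fix e :: real assume "e > 0"
    from Z[OF this] show "\<forall>\<^sub>F m in sequentially. \<forall>t\<in>{0..T}. norm (integral {0..t} (u m) - snd (Z t)) \<le> e"
    proof eventually_elim
      case (elim m)
      show ?case
      proof
        fix t assume t: "t \<in> {0..T}"
        show "norm (integral {0..t} (u m) - snd (Z t)) \<le> e"
          using elim[rule_format, OF t]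
            norm_snd_le[of "snd ((0, integral {0..t} (u m)) - Z t)" "fst ((0, integral {0..t} (u m)) - Z t)"]
          by (cases "Z t") simp
      qed
    qed
  next
    show "\<forall>w. (\<forall>t\<in>{0..T}. integral {0..t} w = snd (Z t)) \<longrightarrow> controlled T (z 0) w z"
    proof (intro allI impI)
      fix w :: "real \<Rightarrow> 'b" assume w: "\<forall>t\<in>{0..T}. integral {0..t} w = snd (Z t)"
      have "z t = z 0 + (0, integral {0..t} w) + integral {0..t} (\<lambda>s. field (z s))" if t: "t \<in> {0..T}" for t
      proof -
        have "(0, integral {0..t} w) = Z t" using fst0[OF t] w t by (simp add: prod_eq_iff)
        then show ?thesis by (simp add: Z_def)
      qed
      then show "controlled T (z 0) w z" unfolding integral_solution_def using z by blast
    qed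
  qed
qed

end

section \<open>Existence of a minimiser\<close>

lemma flat_linear: "linear flat"
  by (rule linearI) (simp_all add: flat_def vec_eq_iff)

lemma bounded_linear_flat: "bounded_linear (flat :: real^'d^'n \<Rightarrow> _)"
  using flat_linear by (simp add: linear_conv_bounded_linear)

lemma continuous_quad_form:
  "continuous_on UNIV (\<lambda>x :: (real^('n \<times> 'd)^('n \<times> 'd)) \<times> (real^'d^'n). quad_form (fst x) (snd x))"
  unfolding quad_form_def
  by (intro continuous_on_inner bounded_bilinear.continuous_on[OF bounded_bilinear_matrix_vector_mult]
      bounded_linear.continuous_on[OF bounded_linear_flat] continuous_on_fst continuous_on_snd
      continuous_on_id)

text \<open>The cross terms cancel for any matrix, symmetric or not, so the convexity argument
  applies to \<open>\<K> q\<close> as given.\<close>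

lemma quad_form_parallelogram:
  "quad_form A ((1/2) *\<^sub>R (a + b)) + quad_form A ((1/2) *\<^sub>R (a - b)) = (quad_form A a + quad_form A b) / 2"
proof -
  have half: "quad_form A ((1/2) *\<^sub>R x) = quad_form A x / 4" for x
    by (simp add: quad_form_def linear_scale[OF flat_linear] matrix_vector_mult_scaleR)
  have "quad_form A (a + b) + quad_form A (a - b) = 2 * (quad_form A a + quad_form A b)"
    by (simp add: quad_form_def linear_add[OF flat_linear] linear_diff[OF flat_linear]
        matrix_vector_right_distrib matrix_vector_mult_diff_distrib inner_add inner_diff)
  then show ?thesis unfolding half by argo
qed

lemma quad_form_bound:
  obtains C where "0 \<le> C"
    "\<And>(A :: real^('n \<times> 'd)^('n \<times> 'd)) (u :: real^'d^'n). \<bar>quad_form A u\<bar> \<le> C * norm A * (norm u)\<^sup>2"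
proof -
  obtain K1 where K1: "0 \<le> K1" "\<And>(A :: real^('n \<times> 'd)^('n \<times> 'd)) x. norm (A *v x) \<le> norm A * norm x * K1"
    using bounded_bilinear.nonneg_bounded[OF bounded_bilinear_matrix_vector_mult] by metis
  obtain K2 where K2: "0 \<le> K2" "\<And>u :: real^'d^'n. norm (flat u) \<le> norm u * K2"
    using bounded_linear.nonneg_bounded[OF bounded_linear_flat] by metis
  have "\<bar>quad_form A u\<bar> \<le> (K1 * K2\<^sup>2) * norm A * (norm u)\<^sup>2"
    for A :: "real^('n \<times> 'd)^('n \<times> 'd)" and u :: "real^'d^'n"
  proof -
    have "\<bar>quad_form A u\<bar> \<le> norm (A *v flat u) * norm (flat u)"
      unfolding quad_form_def by (rule Cauchy_Schwarz_ineq2)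
    also have "\<dots> \<le> (norm A * norm (flat u) * K1) * norm (flat u)"
      by (intro mult_right_mono K1) auto
    also have "\<dots> = norm A * K1 * (norm (flat u))\<^sup>2" by (simp add: power2_eq_square ac_simps)
    also have "\<dots> \<le> norm A * K1 * (norm u * K2)\<^sup>2"
      using K1 by (intro mult_left_mono power_mono K2) auto
    finally show ?thesis by (simp add: power_mult_distrib ac_simps)
  qed
  then show ?thesis using that[of "K1 * K2\<^sup>2"] K1 K2 by auto
qed

lemma quad_form_diff: "quad_form A u - quad_form B u = quad_form (A - B) u"
  by (simp add: quad_form_def matrix_vector_mult_diff_rdistrib inner_diff_left)

text \<open>\<open>trajectory\<close> is described among extensional functions; restriction produces
  that representative of a solution.\<close>

lemma restrict_integral_solution:
  assumes "integral_solution F W \<tau> q"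
  shows "integral_solution F W \<tau> (restrict q {0..\<tau>})"
proof -
  have "integral {0..t} (\<lambda>s. F (restrict q {0..\<tau>} s)) = integral {0..t} (\<lambda>s. F (q s))" if "t \<in> {0..\<tau>}" for t
    using that by (intro integral_cong) auto
  moreover have "continuous_on {0..\<tau>} (restrict q {0..\<tau>})"
    using assms continuous_on_cong[of "{0..\<tau>}" "{0..\<tau>}" q "restrict q {0..\<tau>}"]
    unfolding integral_solution_def by auto
  ultimately show ?thesis using assms by (auto simp: integral_solution_def)
qed

theorem theorem2:
  fixes ev :: "'v::{real_inner, complete_space} \<Rightarrow> real^'d \<Rightarrow> real^'d"
    and K :: "real^'d \<Rightarrow> real^'d \<Rightarrow> real^'d^'d"
    and M :: nat and T c :: real and t :: "nat \<Rightarrow> real"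
    and \<K> :: "(real^'d^'n) \<times> (real^'d^'n) \<Rightarrow> real^('n \<times> 'd)^('n \<times> 'd)"
    and E :: "(real^'d^'n) \<times> (real^'d^'n) \<Rightarrow> real"
    and g :: "nat \<Rightarrow> (real^'d^'n) \<times> (real^'d^'n) \<Rightarrow> real"
  assumes "M \<ge> 1" and "T > 0"
    and "strict_mono_on {1..M} t" and "t ` {1..M} \<subseteq> {0..T}"
    and "hilbert_space_of_fields ev"
    and "continuously_embedded_C1_0 ev"
    and "reproducing_kernel ev K"
    and "class_C2 (\<lambda>(z, z'). K z z')"
    and "continuous_on UNIV \<K>"
    and "c > 0" and "\<And>q u. quad_form (\<K> q) u \<ge> c * (norm u)\<^sup>2"
    and "\<And>q. E q \<ge> 0" and "lower_semicontinuous E" and "filterlim E at_top at_infinity"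
    and "\<And>k q. k \<in> {1..M} \<Longrightarrow> g k q \<ge> 0"
    and "\<And>k. k \<in> {1..M} \<Longrightarrow> continuous_on UNIV (g k)"
  shows "\<exists>q0 u. u \<in> L2 T \<and>
           (\<forall>q0' u'. u' \<in> L2 T \<longrightarrow> J K T \<K> E M t g q0 u \<le> J K T \<K> E M t g q0' u')"
proof -
  note times = assms(4) and \<K>_cont = assms(9) and c = assms(10) and coercive = assms(11)
    and E_nonneg = assms(12) and E_lsc = assms(13) and E_coercive = assms(14)
    and g_nonneg = assms(15) and g_cont = assms(16)
  let ?M = "lebesgue_on {0..T}"
  let ?tr = "trajectory K T" and ?J = "J K T \<K> E M t g"
  have T: "0 \<le> T" using assms(2) by simp
  obtain gx gp :: "(real^'d^'n) \<times> (real^'d^'n) \<Rightarrow> real^'d^'n"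
    and v :: "real^'d^'n \<Rightarrow> real^'d^'n \<Rightarrow> 'v" and C :: real
    where ham: "kernel_hamiltonian (\<lambda>q. H0 K (fst q) (snd q)) gx gp v C"
      and dx: "\<And>x p. dx_H0 K x p = gx (x, p)" and dp: "\<And>x p. dp_H0 K x p = gp (x, p)"
    by (rule kernel_hamiltonian_H0[OF assms(6,7,8)]) (rule that)
  interpret kernel_hamiltonian "\<lambda>q. H0 K (fst q) (snd q)" gx gp v C by (rule ham)

  \<comment> \<open>Trajectories as solutions of the integral equation\<close>
  have lebesgue_eq: "integrable (lebesgue_on {0..s}) f" "integral\<^sup>L (lebesgue_on {0..s}) f = integral {0..s} f"
    if "continuous_on {0..s} f" for s and f :: "real \<Rightarrow> real^'d^'n"
  proof -
    show i: "integrable (lebesgue_on {0..s}) f"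
      using absolutely_integrable_continuous_real[OF that]
      by (simp add: set_integrable_def integrable_restrict_space)
    show "integral\<^sup>L (lebesgue_on {0..s}) f = integral {0..s} f"
      by (rule lebesgue_integral_eq_integral[OF i]) simp
  qed
  have gpx: "continuous_on UNIV gp" "continuous_on UNIV gx"
    using continuous_on_fst[OF continuous_field] continuous_on_minus[OF continuous_on_snd[OF continuous_field]]
    by (simp_all add: field_def)
  \<comment> \<open>The two formulations differ in the integral used and in splitting the state into
    components; on continuous curves with integrable controls they agree.\<close>
  have solution_iff: "solution K T q0 u q \<longleftrightarrow> controlled T q0 u q" if u: "u \<in> L2 T" for q0 u q
  proof -
    have "(fst (q r) = fst q0 + (\<integral>s. dp_H0 K (fst (q s)) (snd (q s)) \<partial>lebesgue_on {0..r}) \<and>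
        snd (q r) = snd q0 + (\<integral>s. - dx_H0 K (fst (q s)) (snd (q s)) + u s \<partial>lebesgue_on {0..r})) \<longleftrightarrow>
        q r = q0 + (0, integral {0..r} u) + integral {0..r} (\<lambda>s. field (q s))"
      if q: "continuous_on {0..T} q" and r: "r \<in> {0..T}" for r
    proof -
      have qr: "continuous_on {0..r} q" by (rule continuous_on_subset[OF q]) (use r in auto)
      note cont = continuous_on_compose2[OF gpx(1) qr subset_UNIV] continuous_on_compose2[OF gpx(2) qr subset_UNIV]
      note ur = integrable_lebesgue_on_initial[OF L2_integrable[OF u] r]
      have "(\<integral>s. - gx (q s) + u s \<partial>lebesgue_on {0..r}) = - integral {0..r} (\<lambda>s. gx (q s)) + integral {0..r} u"
        using lebesgue_eq[OF cont(2)] ur(1,2) by simp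
      then show ?thesis
        unfolding dx dp prod.collapse lebesgue_eq(2)[OF cont(1)] integral_field[OF qr]
        by (simp add: prod_eq_iff add_diff_eq)
    qed
    then show ?thesis unfolding solution_def integral_solution_def by blast
  qed
  have tr: "controlled T q0 u (?tr q0 u)" and tr_eq: "\<And>q s. controlled T q0 u q \<Longrightarrow> s \<in> {0..T} \<Longrightarrow> ?tr q0 u s = q s"
    if u: "u \<in> L2 T" for q0 u
  proof -
    obtain q where q: "controlled T q0 u q" "\<And>q' s. controlled T q0 u q' \<Longrightarrow> s \<in> {0..T} \<Longrightarrow> q' s = q s"
      using controlled_exists[OF T u] by blast
    \<comment> \<open>Existence and uniqueness on \<open>[0,T]\<close> give the definite description
      in \<open>trajectory\<close> its meaning.\<close>
    have "?tr q0 u = restrict q {0..T}"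
      unfolding trajectory_def solution_iff[OF u]
    proof (rule the_equality)
      show "restrict q {0..T} \<in> extensional {0..T} \<and> controlled T q0 u (restrict q {0..T})"
        using restrict_integral_solution[OF q(1)] by simp
      fix q' assume "q' \<in> extensional {0..T} \<and> controlled T q0 u q'"
      then show "q' = restrict q {0..T}"
        using q(2) by (intro extensionalityI[of q' "{0..T}"]) auto
    qed
    then show tr: "controlled T q0 u (?tr q0 u)" using restrict_integral_solution[OF q(1)] by simp
    fix q' s assume "controlled T q0 u q'" "s \<in> {0..T}"
    then show "?tr q0 u s = q' s" using q(2) tr by metis
  qed
  have tr_cont: "continuous_on {0..T} (?tr q0 u)" if "u \<in> L2 T"
    for q0 and u :: "real \<Rightarrow> real^'d^'n"
    using tr[OF that] by (simp add: integral_solution_def)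

  \<comment> \<open>The cost along a continuous curve\<close>
  obtain CQ where CQ: "0 \<le> CQ"
    "\<And>(A :: real^('n \<times> 'd)^('n \<times> 'd)) (u :: real^'d^'n). \<bar>quad_form A u\<bar> \<le> CQ * norm A * (norm u)\<^sup>2"
    by (rule quad_form_bound) (rule that)
  have cost_coercive: "c / 2 * (norm a)\<^sup>2 \<le> cost \<K> z a" for z a
    using coercive[of a z] by (simp add: cost_def)
  have cost_nonneg: "0 \<le> cost \<K> z a" for z a
    by (rule order_trans[OF _ cost_coercive]) (use c in simp)
  have \<K>q: "continuous_on {0..T} (\<lambda>s. \<K> (q s))" if "continuous_on {0..T} q" for q
    by (rule continuous_on_compose2[OF \<K>_cont that]) simp
  have cost_measurable: "(\<lambda>s. cost \<K> (q s) (w s)) \<in> borel_measurable ?M"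
    if q: "continuous_on {0..T} q" and w: "w \<in> borel_measurable ?M" for q w
  proof -
    have "(\<lambda>s. \<K> (q s)) \<in> borel_measurable ?M"
      by (rule continuous_imp_measurable_on_sets_lebesgue[OF \<K>q[OF q]]) simp
    then have "(\<lambda>s. quad_form (\<K> (q s)) (w s)) \<in> borel_measurable ?M"
      by (rule borel_measurable_continuous_Pair[OF _ w continuous_quad_form])
    then show ?thesis unfolding cost_def by measurable
  qed
  have cost_integrable: "integrable ?M (\<lambda>s. cost \<K> (q s) (w s))"
    if q: "continuous_on {0..T} q" and w: "w \<in> L2 T" for q w
  proof -
    have "bounded ((\<lambda>s. \<K> (q s)) ` {0..T})"
      by (intro compact_imp_bounded compact_continuous_image \<K>q[OF q]) simp
    then obtain b where b: "b > 0" "\<And>s. s \<in> {0..T} \<Longrightarrow> norm (\<K> (q s)) \<le> b"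
      unfolding bounded_pos by auto
    show ?thesis
    proof (rule Bochner_Integration.integrable_bound)
      show "integrable ?M (\<lambda>s. CQ * b * (norm (w s))\<^sup>2)"
        by (intro Bochner_Integration.integrable_mult_right L2_norm_square w)
      show "AE s in ?M. norm (cost \<K> (q s) (w s)) \<le> norm (CQ * b * (norm (w s))\<^sup>2)"
      proof (rule AE_I2)
        fix s assume "s \<in> space ?M"
        then have s: "s \<in> {0..T}" by simp
        have "norm (cost \<K> (q s) (w s)) \<le> \<bar>quad_form (\<K> (q s)) (w s)\<bar>" by (simp add: cost_def)
        also have "\<dots> \<le> CQ * norm (\<K> (q s)) * (norm (w s))\<^sup>2" by (rule CQ)
        also have "\<dots> \<le> CQ * b * (norm (w s))\<^sup>2"
          using CQ b s by (intro mult_right_mono mult_left_mono) auto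
        finally show "norm (cost \<K> (q s) (w s)) \<le> norm (CQ * b * (norm (w s))\<^sup>2)"
          using CQ b by simp
      qed
    qed (rule cost_measurable[OF q L2_measurable[OF w]])
  qed
  \<comment> \<open>Curve and control are separate arguments, so that a control can be evaluated
    along a trajectory other than its own.\<close>
  define I where "I q w = (\<integral>s. cost \<K> (q s) (w s) \<partial>?M)" for q w
  have I_nonneg: "0 \<le> I q w" for q w unfolding I_def by (simp add: cost_nonneg)
  define G where "G q = (\<Sum>k = 1..M. g k (q (t k)))" for q
  have G_nonneg: "0 \<le> G q" for q unfolding G_def by (intro sum_nonneg g_nonneg)
  have J_eq: "?J q0 u = E q0 + I (?tr q0 u) u + G (?tr q0 u)" for q0 u
    by (simp add: J_def I_def G_def)

  \<comment> \<open>A minimising sequence and its limit trajectory\<close>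
  define S where "S = {?J q0 u | q0 u. u \<in> L2 T}"
  define \<mu> where "\<mu> = Inf S"
  have "(\<lambda>_. 0) \<in> L2 T" by (simp add: L2_def)
  then have S_ne: "S \<noteq> {}" unfolding S_def by blast
  have bdd: "bdd_below S"
    unfolding S_def using E_nonneg I_nonneg G_nonneg
    by (intro bdd_belowI[of _ 0]) (auto simp: J_eq intro!: add_nonneg_nonneg)
  have \<mu>_le: "\<mu> \<le> ?J q0 u" if "u \<in> L2 T" for q0 u
    unfolding \<mu>_def by (rule cInf_lower[OF _ bdd]) (unfold S_def, use that in blast)
  have "\<exists>q0 u. u \<in> L2 T \<and> ?J q0 u < \<mu> + 1 / real (Suc m)" for m
    using cInf_lessD[OF S_ne, of "\<mu> + 1 / real (Suc m)"] by (auto simp: \<mu>_def S_def)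
  then obtain q0 u where u: "\<And>m. u m \<in> L2 T" and min: "\<And>m. ?J (q0 m) (u m) < \<mu> + 1 / real (Suc m)"
    by metis
  define q where "q m = ?tr (q0 m) (u m)" for m
  have q: "controlled T (q0 m) (u m) (q m)" for m unfolding q_def by (rule tr[OF u])
  have qc: "continuous_on {0..T} (q m)" for m unfolding q_def by (rule tr_cont[OF u])
  have bound: "E (q0 m) + I (q m) (u m) \<le> \<mu> + 1" for m
  proof -
    have "1 / real (Suc m) \<le> 1" by simp
    then show ?thesis using min[of m] G_nonneg[of "q m"] unfolding J_eq q_def by linarith
  qed
  have "\<forall>\<^sub>F z in at_infinity. \<mu> + 1 < E z" using E_coercive by (simp add: filterlim_at_top_dense)
  then obtain r where r: "\<And>z. r \<le> norm z \<Longrightarrow> \<mu> + 1 < E z" by (auto simp: eventually_at_infinity)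
  have q0r: "norm (q0 m) \<le> r" for m
    using r[of "q0 m"] bound[of m] I_nonneg[of "q m" "u m"] by force
  \<comment> \<open>The terms of the functional are nonnegative, so the cost is at most
    \<open>\<mu> + 1\<close>, and it dominates \<open>c / 2\<close> times the squared norm of the
    control.\<close>
  define B where "B = 2 / c * (\<mu> + 1)"
  have uB: "(LINT s|?M. (norm (u m s))\<^sup>2) \<le> B" for m
  proof -
    have "c / 2 * (LINT s|?M. (norm (u m s))\<^sup>2) = (LINT s|?M. c / 2 * (norm (u m s))\<^sup>2)" by simp
    also have "\<dots> \<le> I (q m) (u m)"
      unfolding I_def
      by (intro integral_mono Bochner_Integration.integrable_mult_right L2_norm_square u
          cost_integrable qc cost_coercive)
    also have "\<dots> \<le> \<mu> + 1" using bound[of m] E_nonneg[of "q0 m"] by linarith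
    finally show ?thesis using c by (simp add: B_def field_simps)
  qed
  obtain k1 z R where k1: "strict_mono k1" and z: "continuous_on {0..T} z"
    and R: "\<And>m s. s \<in> {0..T} \<Longrightarrow> norm (q m s) \<le> R"
    and lim1: "uniform_limit {0..T} (\<lambda>m. q (k1 m)) z sequentially"
    by (rule controlled_compactness[OF T u uB q0r q]) (rule that)
  have I_range: "\<forall>m. I (q (k1 m)) (u (k1 m)) \<in> {0..\<mu> + 1}"
  proof
    fix m
    show "I (q (k1 m)) (u (k1 m)) \<in> {0..\<mu> + 1}"
      using bound[of "k1 m"] E_nonneg[of "q0 (k1 m)"] I_nonneg by auto
  qed
  \<comment> \<open>The costs lie in a compact interval; a further extraction gives them a limit
    \<open>l\<close>, which will bound the cost of the limit control.\<close>
  obtain l k2 where k2: "strict_mono k2"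
    and lim_I: "((\<lambda>m. I (q (k1 m)) (u (k1 m))) \<circ> k2) \<longlonglongrightarrow> l"
    by (rule seq_compactE[OF compact_imp_seq_compact[OF compact_Icc] I_range]) (rule that)
  define k where "k m = k1 (k2 m)" for m
  have k: "strict_mono k" using strict_mono_o[OF k1 k2] by (simp add: k_def[abs_def] o_def)
  have lim: "uniform_limit {0..T} (\<lambda>m. q (k m)) z sequentially"
    using filterlim_compose[OF lim1 filterlim_subseq[OF k2]] by (simp add: k_def)
  have lim_I: "(\<lambda>m. I (q (k m)) (u (k m))) \<longlonglongrightarrow> l" using lim_I by (simp add: k_def o_def)
  have zR: "norm (z s) \<le> R" if s: "s \<in> {0..T}" for s
    by (rule tendsto_upperbound[OF tendsto_norm[OF tendsto_uniform_limitI[OF lim s]]])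
       (use R[OF s] in auto)

  \<comment> \<open>Freezing the cost at the limit trajectory\<close>
  have "uniform_limit {0..T} (\<lambda>m s. \<K> (q (k m) s)) (\<lambda>s. \<K> (z s)) sequentially"
  proof (rule uniform_limitI)
    fix e :: real assume e: "e > 0"
    have "uniformly_continuous_on (cball 0 R) \<K>"
      by (intro compact_uniformly_continuous continuous_on_subset[OF \<K>_cont]) auto
    then obtain d where d: "d > 0"
      "\<And>x y. x \<in> cball 0 R \<Longrightarrow> y \<in> cball 0 R \<Longrightarrow> dist y x < d \<Longrightarrow> dist (\<K> y) (\<K> x) < e"
      unfolding uniformly_continuous_on_def using e by meson
    from uniform_limitD[OF lim d(1)]
    show "\<forall>\<^sub>F m in sequentially. \<forall>s\<in>{0..T}. dist (\<K> (q (k m) s)) (\<K> (z s)) < e"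
    proof eventually_elim
      case (elim m)
      then show ?case using d(2) zR R by (auto simp: dist_norm)
    qed
  qed
  note lim_\<K> = this
  have B0: "0 \<le> B" by (rule order_trans[OF _ uB[of 0]]) simp
  \<comment> \<open>The form is linear in the matrix, so exchanging trajectories changes the cost by
    at most the uniform distance of the matrices times the L^2 bound, up to the constant
    \<open>CQ\<close>.\<close>
  have I_diff: "\<bar>I z (u (k m)) - I (q (k m)) (u (k m))\<bar> \<le> CQ * e * B"
    if e: "e \<ge> 0" "\<forall>s\<in>{0..T}. dist (\<K> (q (k m) s)) (\<K> (z s)) < e" for m e
  proof -
    note int = cost_integrable[OF z u] cost_integrable[OF qc u]
    have "\<bar>I z (u (k m)) - I (q (k m)) (u (k m))\<bar> =
        norm (LINT s|?M. cost \<K> (z s) (u (k m) s) - cost \<K> (q (k m) s) (u (k m) s))"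
      unfolding I_def by (subst Bochner_Integration.integral_diff[OF int]) simp
    also have "\<dots> \<le> (LINT s|?M. CQ * e * (norm (u (k m) s))\<^sup>2)"
    proof (rule Bochner_Integration.integral_norm_bound_integral)
      show "integrable ?M (\<lambda>s. cost \<K> (z s) (u (k m) s) - cost \<K> (q (k m) s) (u (k m) s))"
        by (intro Bochner_Integration.integrable_diff int)
      show "integrable ?M (\<lambda>s. CQ * e * (norm (u (k m) s))\<^sup>2)"
        by (intro Bochner_Integration.integrable_mult_right L2_norm_square u)
      fix s assume "s \<in> space ?M"
      then have s: "s \<in> {0..T}" by simp
      have "norm (cost \<K> (z s) (u (k m) s) - cost \<K> (q (k m) s) (u (k m) s)) \<le>
          \<bar>quad_form (\<K> (z s) - \<K> (q (k m) s)) (u (k m) s)\<bar>"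
        by (simp add: cost_def flip: quad_form_diff)
      also have "\<dots> \<le> CQ * norm (\<K> (z s) - \<K> (q (k m) s)) * (norm (u (k m) s))\<^sup>2" by (rule CQ)
      also have "\<dots> \<le> CQ * e * (norm (u (k m) s))\<^sup>2"
        using CQ e(2) s by (intro mult_right_mono mult_left_mono)
          (auto simp: dist_norm norm_minus_commute less_imp_le)
      finally show "norm (cost \<K> (z s) (u (k m) s) - cost \<K> (q (k m) s) (u (k m) s))
          \<le> CQ * e * (norm (u (k m) s))\<^sup>2" .
    qed
    also have "\<dots> = CQ * e * (LINT s|?M. (norm (u (k m) s))\<^sup>2)" by simp
    also have "\<dots> \<le> CQ * e * B" using CQ e by (intro mult_left_mono uB) auto
    finally show ?thesis .
  qed
  have "(\<lambda>m. I z (u (k m)) - I (q (k m)) (u (k m))) \<longlonglongrightarrow> 0"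
  proof (rule tendstoI)
    fix e :: real assume e: "e > 0"
    define e' where "e' = e / (CQ * B + 1)"
    have CB: "0 \<le> CQ * B" using CQ B0 by simp
    have e': "e' > 0" using e CB by (simp add: e'_def)
    have "CQ * e' * B = CQ * B * e / (CQ * B + 1)" by (simp add: e'_def)
    also have "\<dots> < e" using e CB by (simp add: divide_less_eq algebra_simps)
    finally have small: "CQ * e' * B < e" .
    from uniform_limitD[OF lim_\<K> e']
    show "\<forall>\<^sub>F m in sequentially. dist (I z (u (k m)) - I (q (k m)) (u (k m))) 0 < e"
    proof eventually_elim
      case (elim m)
      show ?case using I_diff[OF less_imp_le[OF e'] elim] small by simp
    qed
  qed
  from tendsto_add[OF this lim_I] have lim_Iz: "(\<lambda>m. I z (u (k m))) \<longlonglongrightarrow> l" by simp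

  \<comment> \<open>The limit control\<close>
  obtain U where U: "\<And>e. e > 0 \<Longrightarrow>
      \<forall>\<^sub>F m in sequentially. \<forall>t\<in>{0..T}. norm (integral {0..t} (u (k m)) - U t) \<le> e"
    and Uz: "\<forall>w. (\<forall>t\<in>{0..T}. integral {0..t} w = U t) \<longrightarrow> controlled T (z 0) w z"
    by (rule controlled_limit[OF T q z R lim]) (assumption, rule that)
  have "\<exists>w\<in>L2 T. (\<forall>t\<in>{0..T}. integral {0..t} w = U t) \<and> (LINT s|?M. cost \<K> (z s) (w s)) \<le> l"
  proof (rule L2_quadratic_lower_semicontinuity[OF T _ _ _ _ _ _ u U])
    show "0 < c / 2" using c by simp
    show "(\<lambda>m. LINT s|?M. cost \<K> (z s) (u (k m) s)) \<longlonglongrightarrow> l"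
      using lim_Iz by (simp add: I_def)
    show "cost \<K> (z s) ((1/2) *\<^sub>R (a + b)) + cost \<K> (z s) ((1/2) *\<^sub>R (a - b)) =
        (cost \<K> (z s) a + cost \<K> (z s) b) / 2" for s a b
      using quad_form_parallelogram[of "\<K> (z s)" a b] unfolding cost_def by argo
    show "continuous_on UNIV (\<lambda>a. cost \<K> (z s) a)" for s
      unfolding cost_def
      by (intro continuous_on_mult_left continuous_on_compose2[OF continuous_quad_form, of _ "\<lambda>a. (\<K> (z s), a)", simplified]
          continuous_intros)
  qed (use cost_measurable[OF z] cost_integrable[OF z] cost_coercive in auto)
  then obtain w where w: "w \<in> L2 T" "\<forall>t\<in>{0..T}. integral {0..t} w = U t" and Iw: "I z w \<le> l"
    by (auto simp: I_def)
  \<comment> \<open>\<open>w\<close> has primitive \<open>U\<close>, so \<open>z\<close> solves its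
    integral equation, and uniqueness identifies \<open>z\<close> with the trajectory of
    \<open>w\<close> from \<open>z 0\<close>.\<close>
  have trz: "?tr (z 0) w s = z s" if "s \<in> {0..T}" for s
    by (rule tr_eq[OF w(1) Uz[rule_format, OF w(2)[rule_format]] that])
  have t_in: "t i \<in> {0..T}" if "i \<in> {1..M}" for i using times that by blast
  have Itr: "I (?tr (z 0) w) w = I z w"
    unfolding I_def by (rule Bochner_Integration.integral_cong) (simp_all add: trz)
  have Gtr: "G (?tr (z 0) w) = G z"
    unfolding G_def by (intro sum.cong refl) (simp only: trz[OF t_in])

  \<comment> \<open>Passage to the limit in the functional\<close>
  have q_lim: "(\<lambda>m. q (k m) s) \<longlonglongrightarrow> z s" if "s \<in> {0..T}" for s
    by (rule tendsto_uniform_limitI[OF lim that])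
  have G_lim: "(\<lambda>m. G (q (k m))) \<longlonglongrightarrow> G z"
    unfolding G_def
  proof (intro tendsto_sum)
    fix i assume i: "i \<in> {1..M}"
    then have "isCont (g i) (z (t i))" using g_cont[OF i] by (cases "z (t i)") (simp add: continuous_on_eq_continuous_at)
    then show "(\<lambda>m. g i (q (k m) (t i))) \<longlonglongrightarrow> g i (z (t i))"
      by (rule isCont_tendsto_compose) (rule q_lim[OF t_in[OF i]])
  qed
  \<comment> \<open>\<open>E\<close> is only lower semicontinuous, so \<open>E (z 0)\<close> is
    compared with \<open>E (q0 (k m))\<close> up to a loss \<open>e\<close>; the costs and the terms
    \<open>g\<close> converge along the subsequence.\<close>
  have "?J (z 0) w \<le> \<mu>"
  proof (rule field_le_epsilon)
    fix e :: real assume e: "e > 0"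
    have "(\<lambda>m. q0 (k m)) \<longlonglongrightarrow> z 0"
      using q_lim[of 0] T controlled_initial[OF T q] by simp
    moreover have "open {x. E (z 0) - e < E x}" using E_lsc by (simp add: lower_semicontinuous_def)
    ultimately have "\<forall>\<^sub>F m in sequentially. E (z 0) - e < E (q0 (k m))"
      using e by (auto dest!: topological_tendstoD)
    then have ev: "\<forall>\<^sub>F m in sequentially.
        E (z 0) - e + I (q (k m)) (u (k m)) + G (q (k m)) \<le> \<mu> + 1 / real (Suc (k m))"
    proof eventually_elim
      case (elim m)
      then show ?case using min[of "k m"] by (simp add: J_eq q_def)
    qed
    have "(\<lambda>m. 1 / real (Suc (k m))) \<longlonglongrightarrow> 0"
      using LIMSEQ_subseq_LIMSEQ[OF LIMSEQ_Suc[OF lim_1_over_n] k] by (simp add: o_def)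
    then have r: "(\<lambda>m. \<mu> + 1 / real (Suc (k m))) \<longlonglongrightarrow> \<mu> + 0" by (intro tendsto_intros)
    have "(\<lambda>m. E (z 0) - e + I (q (k m)) (u (k m)) + G (q (k m))) \<longlonglongrightarrow> E (z 0) - e + l + G z"
      by (intro tendsto_intros lim_I G_lim)
    from tendsto_le[OF _ r this ev] have "E (z 0) - e + l + G z \<le> \<mu>" by simp
    then show "?J (z 0) w \<le> \<mu> + e" using Iw by (simp add: J_eq Itr Gtr)
  qed
  then show ?thesis using w(1) \<mu>_le by (meson order_trans)
qed

end
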